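(* Let the system, the disturbance law $\omega$, the gains $K,K_f$, the sets $\mathcal X,\mathcal U,\mathcal Z,\mathcal V,\mathcal Z_f$, the costs, the feasible set $\mathbb X_N$ and the feedback laws $\bar\kappa_N,\kappa_N$ be as defined in the context, and suppose that all assumptions (A1)--(A5) listed there hold. Let $\rho_\infty$ denote the stationary process (stationary law) of the system $s_{k+1}=A_Ks_k+w_k$ with $w_k\sim\omega$. Then, for all $z_0\in\mathbb X_N$: (i) the MPC optimization problem $V_N^\star(z_k)$ is recursively feasible, i.e. along the nominal closed loop $z_{k+1}=Az_k+B\bar\kappa_N(z_k)$ started at $z_0$ one has $z_k\in\mathbb X_N$ for all $k\in\mathbb N$; (ii) the MPC-controlled nominal system $z_{k+1}=Az_k+B\bar\kappa_N(z_k)$, considered on the state space $\mathbb X_N$, is asymptotically stable to the origin (the origin is Lyapunov stable and $z_k\to0$ as $k\to\infty$); (iii) the real state $x_k$ of the MPC-controlled system $x_{k+1}=Ax_k+B\kappa_N(x_k)+w_k$, $w_k\sim\omega$, converges (in distribution) to the stationary process $\rho_\infty$ as $k\to\infty$.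
   Context: Notation: $\mathbb N$ is the set of non-negative integers and $\mathbb N_+$ the positive integers; $\mathbb S^n_{++}$ is the set of symmetric positive definite $n\times n$ matrices. For nonempty sets, $\mathcal X\oplus\mathcal Y=\{x+y: x\in\mathcal X,y\in\mathcal Y\}$ and $\mathcal X\ominus\mathcal Y=\{x:\forall y\in\mathcal Y,\ x+y\in\mathcal X\}$; $M\mathcal X=\{Mx:x\in\mathcal X\}$. For $M\in\mathbb S^n_{++}$, $c\in\mathbb R^n$, $r>0$: $\mathcal E(M,c,r)=\{x:(x-c)^\intercal M^{-1}(x-c)\le r\}$. A square matrix is strictly stable if all its eigenvalues lie in the open unit disc. System: $x_{k+1}=Ax_k+Bu_k+w_k$, $k\in\mathbb N$, with $x_k\in\mathbb R^n$, $u_k\in\mathbb R^m$; the disturbances $w_0,w_1,\dots$ are $\mathbb R^n$-valued, i.i.d. with law $\omega$, and $w_k$ is independent of $x_k$ and $u_k$. Given $\epsilon_x,\epsilon_u\in(0,1)$. (A1) (i) $(A,B)\in\mathbb R^{n\times n}\times\mathbb R^{n\times m}$ is known and strictly stabilizable. (ii) $\mathcal X\subseteq\mathbb R^n$ is a convex polyhedron and $\mathcal U\subseteq\mathbb R^m$ a convex polytope, both containing the origin in their interior, with irredundant representations $\mathcal X=\{x: f_i^\intercal x\le1,\ i=1,\dots,n_{\mathcal X}\}$ and $\mathcal U=\{u: g_i^\intercal u\le 1,\ i=1,\dots,n_{\mathcal U}\}$, with $f_i\in\mathbb R^n$, $g_i\in\mathbb R^m$. (iii) $\omega$ has known mean $\mu_\omega\in\mathbb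 R^n$ and covariance $\Sigma_\omega\in\mathbb S^n_{++}$. (A2) $K\in\mathbb R^{m\times n}$ is given and $A_K:=A+BK$ is strictly stable. (A3) For $\epsilon=\epsilon_x$ and $\epsilon=\epsilon_u$, the set $\mathcal E(\Sigma_\omega,\mu_\omega,n/\epsilon)$ contains the origin in its interior. The sets $\mathcal R^{\epsilon}(q^* )$: fix vectors $p_1,\dots,p_r\in\mathbb R^n$ spanning $\mathbb R^n$. For $q\in\mathbb R^r$ with $q_i\ge0$ let $\mathcal R^\epsilon(q)=\{x\in\mathbb R^n: p_i^\intercal x\le q_i,\ i=1,\dots,r\}$. For $\epsilon\in\{\epsilon_x,\epsilon_u\}$ set $q^*=c^*+d^*$ (depending on $\epsilon$), where $d_i^*=\mu_\omega^\intercal p_i+\sqrt{n(p_i^\intercal\Sigma_\omega p_i)/\epsilon}$ and $c^*$ is the $c$-component of the solution of the linear program: maximize $\sum_{i=1}^r c_i$ over $c\in\mathbb R^r$ and $\xi_1,\dots,\xi_r\in\mathbb R^n$ subject to $c_i\le p_i^\intercal A_K\xi_i$ for all $i$, and $p_j^\intercal\xi_i\le c_j+d_j^*$ for all $i,j$. Tightened sets: $\mathcal Z:=\mathcal X\ominus\mathcal R^{\epsilon_x}(q^* )$ and $\mathcal V:=\mathcal U\ominus K\mathcal R^{\epsilon_u}(q^* )$. (A4) $\mathcal Z$ is a nonempty convex polyhedron containing the origin in its interior, and $\mathcal V$ is a nonempty convex polytope containing the origin in its interior. Costs: $\ell(z,v)=z^\intercal Qz+v^\intercal Rv$, $V_f(z)=z^\intercal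 Pz$, with $P,Q\in\mathbb S^n_{++}$, $R\in\mathbb S^m_{++}$. (A5) (i) $K_f\in\mathbb R^{m\times n}$ is such that $A_{K_f}:=A+BK_f$ is strictly stable; $\mathcal Z_f$ is a convex polyhedron and is the maximal positively invariant set for the system $z^+=A_{K_f}z$ under the constraints $(z,K_fz)\in\mathcal Z\times\mathcal V$. (ii) For all $z\in\mathcal Z_f$: $V_f((A+BK_f)z)+\ell(z,K_fz)\le V_f(z)$. MPC problem: given a horizon $N\in\mathbb N_+$ and a nominal state $z_k\in\mathbb R^n$, $$V_N^\star(z_k)=\min_{z_{0|k},\dots,z_{N|k},\,v_{0|k},\dots,v_{N-1|k}}\ \sum_{t=0}^{N-1}\ell(z_{t|k},v_{t|k})+V_f(z_{N|k})$$ subject to $z_{t+1|k}=Az_{t|k}+Bv_{t|k}$ for $t=0,\dots,N-1$; $z_{t|k}\in\mathcal Z$ for $t=1,\dots,N-1$; $v_{t|k}\in\mathcal V$ for $t=0,\dots,N-1$; $z_{N|k}\in\mathcal Z_f$; $z_{0|k}=z_k$. The feasible set $\mathbb X_N$ is the set of $z_k\in\mathbb R^n$ for which this problem is feasible. For $z_k\in\mathbb X_N$, $v_{0|k}^\star(z_k)$ is the first control of the minimizer. Feedback laws: $\bar\kappa_N(z_k)=v_{0|k}^\star(z_k)$ for the nominal system, and $\kappa_N(x_k)=\bar\kappa_N(z_k)+K(x_k-z_k)$ for the real system, where $z_k$ is the state of the nominal closed loop $z_{k+1}=Az_k+B\bar\kappa_N(z_k)$. The error $s_k=x_k-z_k$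 then satisfies $s_{k+1}=A_Ks_k+w_k$. *)

theory Defs
  imports "HOL-Probability.Probability"
begin

section \<open>Matrices and sets\<close>

definition posdef :: "real^'n^'n \<Rightarrow> bool" where
  "posdef M \<longleftrightarrow> transpose M = M \<and> (\<forall>x. x \<noteq> 0 \<longrightarrow> x \<bullet> (M *v x) > 0)"

text \<open>The eigenvalues of a real matrix are those of its complexification.\<close>

definition eigenvalues :: "real^'n^'n \<Rightarrow> complex set" where
  "eigenvalues M =
     {l. \<exists>v :: complex^'n. v \<noteq> 0 \<and> (\<chi> i j. complex_of_real (M $ i $ j)) *v v = l *s v}"

definition strictly_stable :: "real^'n^'n \<Rightarrow> bool" where
  "strictly_stable M \<longleftrightarrow> (\<forall>l \<in> eigenvalues M. cmod l < 1)"

definition strictly_stabilizable :: "real^'n^'n \<Rightarrow> real^'m^'n \<Rightarrow> bool" where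
  "strictly_stabilizable A B \<longleftrightarrow> (\<exists>L :: real^'n^'m. strictly_stable (A + B ** L))"

definition ellipsoid :: "real^'n^'n \<Rightarrow> real^'n \<Rightarrow> real \<Rightarrow> (real^'n) set" where
  "ellipsoid M c r = {x. (x - c) \<bullet> (matrix_inv M *v (x - c)) \<le> r}"

definition pontryagin_diff :: "'a::plus set \<Rightarrow> 'a set \<Rightarrow> 'a set" where
  "pontryagin_diff X Y = {x. \<forall>y\<in>Y. x + y \<in> X}"

definition irredundant_rep :: "'a::real_inner set \<Rightarrow> (nat \<Rightarrow> 'a) \<Rightarrow> nat \<Rightarrow> bool" where
  "irredundant_rep S f k \<longleftrightarrow>
     S = {x. \<forall>i\<in>{1..k}. f i \<bullet> x \<le> 1} \<and>
     (\<forall>j\<in>{1..k}. {x. \<forall>i\<in>{1..k} - {j}. f i \<bullet> x \<le> 1} \<noteq> S)"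

text \<open>Here \<open>F\<close> is the autonomous dynamics and \<open>C\<close> the constraint set; ``maximal'' means
  largest with respect to inclusion.\<close>

definition positively_invariant :: "('a \<Rightarrow> 'a) \<Rightarrow> 'a set \<Rightarrow> 'a set \<Rightarrow> bool" where
  "positively_invariant F C S \<longleftrightarrow> S \<subseteq> C \<and> (\<forall>z\<in>S. F z \<in> S)"

definition maximal_positively_invariant :: "('a \<Rightarrow> 'a) \<Rightarrow> 'a set \<Rightarrow> 'a set \<Rightarrow> bool" where
  "maximal_positively_invariant F C S \<longleftrightarrow>
     positively_invariant F C S \<and> (\<forall>T. positively_invariant F C T \<longrightarrow> T \<subseteq> S)"

section \<open>Probabilistic reachable sets\<close>

definition reach_set :: "('r::finite \<Rightarrow> real^'n) \<Rightarrow> real^'r \<Rightarrow> (real^'n) set" where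
  "reach_set p q = {x. \<forall>i. p i \<bullet> x \<le> q $ i}"

definition d_star ::
  "('r::finite \<Rightarrow> real^'n) \<Rightarrow> real^'n \<Rightarrow> real^'n^'n \<Rightarrow> real \<Rightarrow> real^'r" where
  "d_star p \<mu> \<Sigma> \<epsilon> =
     (\<chi> i. \<mu> \<bullet> p i + sqrt (real CARD('n) * (p i \<bullet> (\<Sigma> *v p i)) / \<epsilon>))"

definition lp_feasible ::
  "real^'n^'n \<Rightarrow> ('r::finite \<Rightarrow> real^'n) \<Rightarrow> real^'r \<Rightarrow> real^'r \<Rightarrow> ('r \<Rightarrow> real^'n) \<Rightarrow> bool" where
  "lp_feasible AK p d c \<xi> \<longleftrightarrow>
     (\<forall>i. c $ i \<le> p i \<bullet> (AK *v \<xi> i)) \<and>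
     (\<forall>i j. p j \<bullet> \<xi> i \<le> c $ j + d $ j)"

definition lp_c_solution ::
  "real^'n^'n \<Rightarrow> ('r::finite \<Rightarrow> real^'n) \<Rightarrow> real^'r \<Rightarrow> real^'r \<Rightarrow> bool" where
  "lp_c_solution AK p d c \<longleftrightarrow>
     (\<exists>\<xi>. lp_feasible AK p d c \<xi>) \<and>
     (\<forall>c' \<xi>'. lp_feasible AK p d c' \<xi>' \<longrightarrow> (\<Sum>i\<in>UNIV. c' $ i) \<le> (\<Sum>i\<in>UNIV. c $ i))"

section \<open>The MPC problem\<close>

definition stage_cost :: "real^'n^'n \<Rightarrow> real^'m^'m \<Rightarrow> real^'n \<Rightarrow> real^'m \<Rightarrow> real" where
  "stage_cost Q R z v = z \<bullet> (Q *v z) + v \<bullet> (R *v v)"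

definition terminal_cost :: "real^'n^'n \<Rightarrow> real^'n \<Rightarrow> real" where
  "terminal_cost P z = z \<bullet> (P *v z)"

text \<open>In the following definitions, \<open>zs\<close> and \<open>vs\<close> are sequences of which only the entries
  \<open>zs 0, \<dots>, zs N\<close> and \<open>vs 0, \<dots>, vs (N - 1)\<close> are relevant.\<close>

definition mpc_cost ::
  "real^'n^'n \<Rightarrow> real^'m^'m \<Rightarrow> real^'n^'n \<Rightarrow> nat \<Rightarrow> (nat \<Rightarrow> real^'n) \<Rightarrow> (nat \<Rightarrow> real^'m) \<Rightarrow> real"
where
  "mpc_cost Q R P N zs vs = (\<Sum>t<N. stage_cost Q R (zs t) (vs t)) + terminal_cost P (zs N)"

definition mpc_admissible ::
  "real^'n^'n \<Rightarrow> real^'m^'n \<Rightarrow> (real^'n) set \<Rightarrow> (real^'m) set \<Rightarrow> (real^'n) set \<Rightarrow> nat \<Rightarrow>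
   real^'n \<Rightarrow> (nat \<Rightarrow> real^'n) \<Rightarrow> (nat \<Rightarrow> real^'m) \<Rightarrow> bool"
where
  "mpc_admissible A B Z V Zf N z zs vs \<longleftrightarrow>
     (\<forall>t<N. zs (Suc t) = A *v zs t + B *v vs t) \<and>
     (\<forall>t. 1 \<le> t \<and> t < N \<longrightarrow> zs t \<in> Z) \<and>
     (\<forall>t<N. vs t \<in> V) \<and>
     zs N \<in> Zf \<and>
     zs 0 = z"

definition mpc_feasible_set ::
  "real^'n^'n \<Rightarrow> real^'m^'n \<Rightarrow> (real^'n) set \<Rightarrow> (real^'m) set \<Rightarrow> (real^'n) set \<Rightarrow> nat \<Rightarrow>
   (real^'n) set"
where
  "mpc_feasible_set A B Z V Zf N = {z. \<exists>zs vs. mpc_admissible A B Z V Zf N z zs vs}"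

definition mpc_minimizer ::
  "real^'n^'n \<Rightarrow> real^'m^'n \<Rightarrow> (real^'n) set \<Rightarrow> (real^'m) set \<Rightarrow> (real^'n) set \<Rightarrow>
   real^'n^'n \<Rightarrow> real^'m^'m \<Rightarrow> real^'n^'n \<Rightarrow> nat \<Rightarrow>
   real^'n \<Rightarrow> (nat \<Rightarrow> real^'n) \<Rightarrow> (nat \<Rightarrow> real^'m) \<Rightarrow> bool"
where
  "mpc_minimizer A B Z V Zf Q R P N z zs vs \<longleftrightarrow>
     mpc_admissible A B Z V Zf N z zs vs \<and>
     (\<forall>zs' vs'. mpc_admissible A B Z V Zf N z zs' vs' \<longrightarrow>
        mpc_cost Q R P N zs vs \<le> mpc_cost Q R P N zs' vs')"

definition mpc_law ::
  "real^'n^'n \<Rightarrow> real^'m^'n \<Rightarrow> (real^'n) set \<Rightarrow> (real^'m) set \<Rightarrow> (real^'n) set \<Rightarrow>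
   real^'n^'n \<Rightarrow> real^'m^'m \<Rightarrow> real^'n^'n \<Rightarrow> nat \<Rightarrow> real^'n \<Rightarrow> real^'m"
where
  "mpc_law A B Z V Zf Q R P N z =
     (THE v. \<exists>zs vs. mpc_minimizer A B Z V Zf Q R P N z zs vs \<and> vs 0 = v)"

definition tube_feedback ::
  "(real^'n \<Rightarrow> real^'m) \<Rightarrow> real^'n^'m \<Rightarrow> real^'n \<Rightarrow> real^'n \<Rightarrow> real^'m" where
  "tube_feedback \<kappa> K z x = \<kappa> z + K *v (x - z)"

text \<open>Asymptotic stability of the origin for \<open>z\<^sup>+ = F z\<close> with state space \<open>S\<close>; the first
  two conjuncts say that the origin is an equilibrium in \<open>S\<close>.\<close>

definition asymptotically_stable_on :: "'a::real_normed_vector set \<Rightarrow> ('a \<Rightarrow> 'a) \<Rightarrow> bool" where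
  "asymptotically_stable_on S F \<longleftrightarrow>
     0 \<in> S \<and> F 0 = 0 \<and>
     (\<forall>e>0. \<exists>\<delta>>0. \<forall>z\<in>S. norm z < \<delta> \<longrightarrow> (\<forall>k. norm ((F ^^ k) z) < e)) \<and>
     (\<forall>z\<in>S. (\<lambda>k. (F ^^ k) z) \<longlonglongrightarrow> 0)"

section \<open>Disturbances and stationary laws\<close>

definition mean_vector :: "(real^'n) measure \<Rightarrow> real^'n" where
  "mean_vector \<omega> = (\<integral>x. x \<partial>\<omega>)"

definition covariance_matrix :: "(real^'n) measure \<Rightarrow> real^'n^'n" where
  "covariance_matrix \<omega> =
     (\<chi> i j. \<integral>x. (x $ i - mean_vector \<omega> $ i) * (x $ j - mean_vector \<omega> $ j) \<partial>\<omega>)"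

text \<open>The library's \<open>indep_var\<close> requires both variables to have the same range type;
  the following is its definition without this restriction.\<close>

definition independent_rvs ::
  "'a measure \<Rightarrow> ('a \<Rightarrow> 'b::topological_space) \<Rightarrow> ('a \<Rightarrow> 'c::topological_space) \<Rightarrow> bool" where
  "independent_rvs M X Y \<longleftrightarrow>
     X \<in> borel_measurable M \<and> Y \<in> borel_measurable M \<and>
     prob_space.indep_set M {X -` S \<inter> space M |S. S \<in> sets borel}
                            {Y -` S \<inter> space M |S. S \<in> sets borel}"

text \<open>\<open>x\<close> and \<open>u\<close> are the state and input processes of \<open>x\<^sub>k\<^sub>+\<^sub>1 = A x\<^sub>k + B u\<^sub>k + w\<^sub>k\<close> under
  time-varying feedback \<open>u\<^sub>k = \<kappa> k x\<^sub>k\<close>; the initial state is an arbitrary random vector.\<close>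

definition closed_loop_process ::
  "'a measure \<Rightarrow> (nat \<Rightarrow> 'a \<Rightarrow> real^'n) \<Rightarrow> real^'n^'n \<Rightarrow> real^'m^'n \<Rightarrow>
   (nat \<Rightarrow> real^'n \<Rightarrow> real^'m) \<Rightarrow> (nat \<Rightarrow> 'a \<Rightarrow> real^'n) \<Rightarrow> (nat \<Rightarrow> 'a \<Rightarrow> real^'m) \<Rightarrow> bool"
where
  "closed_loop_process M w A B \<kappa> x u \<longleftrightarrow>
     (\<forall>k. \<forall>a\<in>space M. u k a = \<kappa> k (x k a)) \<and>
     (\<forall>k. \<forall>a\<in>space M. x (Suc k) a = A *v x k a + B *v u k a + w k a) \<and>
     (\<forall>k. independent_rvs M (w k) (\<lambda>a. (x k a, u k a)))"

definition stationary_law :: "real^'n^'n \<Rightarrow> (real^'n) measure \<Rightarrow> (real^'n) measure \<Rightarrow> bool" where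
  "stationary_law AK \<omega> \<rho> \<longleftrightarrow>
     prob_space \<rho> \<and> sets \<rho> = sets borel \<and>
     distr (\<rho> \<Otimes>\<^sub>M \<omega>) borel (\<lambda>(s, w). AK *v s + w) = \<rho>"

text \<open>The library's \<open>weak_conv_m\<close> covers laws on the real line only.\<close>

definition converges_weakly :: "(nat \<Rightarrow> 'a::topological_space measure) \<Rightarrow> 'a measure \<Rightarrow> bool" where
  "converges_weakly \<mu> \<rho> \<longleftrightarrow>
     (\<forall>f :: 'a \<Rightarrow> real. continuous_on UNIV f \<and> bounded (range f) \<longrightarrow>
        (\<lambda>k. \<integral>x. f x \<partial>\<mu> k) \<longlonglongrightarrow> (\<integral>x. f x \<partial>\<rho>))"

end

theory Submission
  imports Defs "HOL-Computational_Algebra.Fundamental_Theorem_Algebra"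
begin

text \<open>
  The error \<open>s = x - z\<close> between the real and the nominal state obeys
  \<open>s\<^sub>k\<^sub>+\<^sub>1 = (A + B K) s\<^sub>k + w\<^sub>k\<close>, whatever the nominal controller does. The theorem thus splits into a
  deterministic statement about the nominal loop and a probabilistic one about this linear
  recursion. They meet in one place: the nominal state tends to the origin, hence shifting the law of
  \<open>s\<^sub>k\<close> by it does not change the weak limit.

  Both halves need one fact on a strictly stable matrix \<open>G\<close>: \<open>\<parallel>G\<^sup>k v\<parallel> \<le> c\<^sub>k \<parallel>v\<parallel>\<close> with summable \<open>c\<close>
  (\<open>strictly_stable_summable_powers\<close>). Every vector is annihilated by a nonzero complex
  polynomial in \<open>G\<close>; linear factors with root outside the open unit disc act injectively and may be
  cancelled, while the others turn the orbit into a recursion with contracting scalar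
  factor and summable input.

  For the recursion, let \<open>\<xi>\<close> be an i.i.d. sequence with law \<open>\<omega>\<close>. By exchangeability, \<open>s\<^sub>k\<close> has the law of
  \<open>G\<^sup>k s\<^sub>0 + \<Sum>j<k. G\<^sup>j \<xi>\<^sub>j\<close> (\<open>iterate_step_law\<close>): with the noise in reversed order, the sum
  converges almost surely and no longer only in law. Its limit has a law that is stationary,
  because prefixing \<open>\<xi>\<close> with one more noise variable amounts to one step of the recursion, and
  dominated convergence makes it the weak limit from every initial law
  (\<open>shifted_iterates_converge\<close>). Started in a stationary law, the recursion stays there, so
  that law must be the limit law.

  For the nominal loop, the minimum exists since the control sequences range over a compact set, and
  its first control is unique by the parallelogram identity for the positive definite
  costs. Appending the terminal feedback to an optimal plan gives a feasible plan for the
  successor state, with a cost lower by at least the first stage cost (\<open>terminal_extension\<close>). This gives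
  recursive feasibility, and it bounds the total stage cost along the closed loop by the initial
  optimal cost, so that the state converges to the origin. Lyapunov stability also needs an upper
  bound on the optimal cost near the origin. The terminal cost is one on \<open>Z\<^sub>f\<close>, and
  \<open>Z\<^sub>f\<close> is a neighbourhood of the origin because it is the maximal invariant set of a stable system
  (\<open>zero_interior_maximal_invariant\<close>).
\<close>

section \<open>Powers of a strictly stable matrix\<close>

text \<open>The vector \<open>p(M) v\<close>, evaluated by Horner's scheme, so that recursion over the
  coefficients of \<open>p\<close> needs no powers of \<open>M\<close>.\<close>
definition poly_act :: "complex^'n^'n \<Rightarrow> complex poly \<Rightarrow> complex^'n \<Rightarrow> complex^'n" where
  "poly_act M p v = fold_coeffs (\<lambda>a u. a *s v + M *v u) p 0"

lemma poly_act_0 [simp]: "poly_act M 0 v = 0"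
  by (simp add: poly_act_def)

lemma poly_act_pCons [simp]: "poly_act M (pCons a p) v = a *s v + M *v poly_act M p v"
  by (cases "p = 0 \<and> a = 0") (auto simp: poly_act_def)

lemma poly_act_add: "poly_act M (p + q) v = poly_act M p v + poly_act M q v"
  by (induction p q rule: poly_induct2)
    (simp_all add: matrix_vector_right_distrib vec.scale_left_distrib)

lemma poly_act_smult: "poly_act M (smult c p) v = c *s poly_act M p v"
  by (induction p) (simp_all add: vec.scale_right_distrib vector_scalar_commute)

lemma poly_act_sum: "poly_act M (\<Sum>i\<in>I. p i) v = (\<Sum>i\<in>I. poly_act M (p i) v)"
  by (induction I rule: infinite_finite_induct) (simp_all add: poly_act_add)

lemma poly_act_monom: "poly_act M (monom c k) v = c *s (((*v) M ^^ k) v)"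
  by (induction k) (simp_all add: monom_0 monom_Suc vector_scalar_commute)

lemma poly_act_apply_commute: "poly_act M p (M *v v) = M *v poly_act M p v"
  by (induction p) (simp_all add: matrix_vector_right_distrib vector_scalar_commute)

lemma poly_act_diff_arg: "poly_act M p (u - v) = poly_act M p u - poly_act M p v"
  by (induction p) (simp_all add: matrix_vector_mult_diff_distrib vec.scale_right_diff_distrib)

lemma poly_act_scale_arg: "poly_act M p (c *s v) = c *s poly_act M p v"
  by (induction p) (simp_all add: vec.scale_right_distrib vector_scalar_commute mult.commute)

lemma poly_act_linear_factor:
  "poly_act M ([:-z, 1:] * q) v = M *v poly_act M q v - z *s poly_act M q v"
proof -
  have "[:-z, 1:] * q = pCons 0 q + smult (-z) q" by simp
  then show ?thesis
    by (simp only: poly_act_add poly_act_smult poly_act_pCons) simp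
qed

text \<open>The vectors \<open>v, M v, \<dots>, M\<^sup>n v\<close> are one more than the dimension, and a linear dependence
  among them is an annihilating polynomial of \<open>v\<close>.\<close>
lemma exists_annihilating_poly:
  fixes M :: "complex^'n^'n"
  shows "\<exists>p. p \<noteq> 0 \<and> poly_act M p v = 0"
proof (rule ccontr)
  assume "\<not> ?thesis"
  then have free: "p = 0" if "poly_act M p v = 0" for p
    using that by blast
  define S where "S = (\<lambda>i. ((*v) M ^^ i) v) ` {..CARD('n)}"
  have inj: "inj_on (\<lambda>i. ((*v) M ^^ i) v) {..CARD('n)}"
  proof (rule inj_onI)
    fix i j
    assume "((*v) M ^^ i) v = ((*v) M ^^ j) v"
    then have "poly_act M (monom 1 i + smult (-1) (monom 1 j)) v = 0"
      by (simp only: poly_act_add poly_act_smult poly_act_monom) simp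
    then have "monom 1 i + smult (-1) (monom 1 j) = (0 :: complex poly)"
      by (rule free)
    then have "monom 1 i = (monom 1 j :: complex poly)"
      by simp
    then show "i = j" by (metis degree_monom_eq one_neq_zero)
  qed
  have "vec.independent S"
    unfolding vec.independent_explicit_finite_subsets
  proof (intro allI impI ballI)
    fix T u x
    assume T: "T \<subseteq> S" "finite T" and 0: "(\<Sum>x\<in>T. u x *s x) = 0" and x: "x \<in> T"
    define I where "I = {i. i \<le> CARD('n) \<and> ((*v) M ^^ i) v \<in> T}"
    have TI: "T = (\<lambda>i. ((*v) M ^^ i) v) ` I"
      using T by (auto simp: I_def S_def)
    have injI: "inj_on (\<lambda>i. ((*v) M ^^ i) v) I"
      by (rule inj_on_subset[OF inj]) (auto simp: I_def)
    have finI: "finite I" by (simp add: I_def)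
    have "poly_act M (\<Sum>i\<in>I. monom (u (((*v) M ^^ i) v)) i) v = 0"
      using 0 by (simp add: poly_act_sum poly_act_monom TI sum.reindex[OF injI])
    then have "(\<Sum>i\<in>I. monom (u (((*v) M ^^ i) v)) i) = 0"
      by (rule free)
    then have "coeff (\<Sum>i\<in>I. monom (u (((*v) M ^^ i) v)) i) j = 0" for j
      by simp
    then have "u (((*v) M ^^ j) v) = 0" if "j \<in> I" for j
    proof -
      have "coeff (\<Sum>i\<in>I. monom (u (((*v) M ^^ i) v)) i) j = u (((*v) M ^^ j) v)"
        using that finI by (simp add: coeff_sum)
      then show ?thesis using \<open>coeff _ j = 0\<close> by simp
    qed
    then show "u x = 0" using x TI by auto
  qed
  then have "card S \<le> CARD('n)"
    by (metis vec.independent_card_le_dim subset_UNIV vec.dim_UNIV finite_class.finite_UNIV card_cart_basis order.trans order_refl)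
  then show False
    by (simp add: S_def card_image[OF inj])
qed

text \<open>Summing \<open>\<parallel>a\<^sub>k\<^sub>+\<^sub>1\<parallel> \<le> |l| \<parallel>a\<^sub>k\<parallel> + \<parallel>y\<^sub>k\<parallel>\<close> bounds each partial sum of \<open>\<parallel>a\<^sub>k\<parallel>\<close> by
  \<open>|l|\<close> times itself plus a constant.\<close>
lemma summable_norm_contracting_recursion:
  fixes a y :: "nat \<Rightarrow> complex^'n"
  assumes "cmod l < 1" and step: "\<And>k. a (Suc k) = l *s a k + y k"
    and y: "summable (\<lambda>k. norm (y k))"
  shows "summable (\<lambda>k. norm (a k))"
proof -
  have n: "norm (l *s x) = cmod l * norm x" for x :: "complex^'n"
    by (simp add: norm_vec_def L2_set_def norm_mult power_mult_distrib
        sum_distrib_left[symmetric] real_sqrt_mult)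
  define Y where "Y = (\<Sum>k. norm (y k))"
  have le: "(\<Sum>k<m. norm (a k)) \<le> (norm (a 0) + Y) / (1 - cmod l)" for m
  proof -
    have "(\<Sum>k<m. norm (a k)) \<le> (\<Sum>k<Suc m. norm (a k))" by simp
    also have "\<dots> = norm (a 0) + (\<Sum>k<m. norm (a (Suc k)))"
      by (rule sum.lessThan_Suc_shift)
    also have "\<dots> \<le> norm (a 0) + (\<Sum>k<m. cmod l * norm (a k) + norm (y k))"
      by (intro add_left_mono sum_mono) (metis step n norm_triangle_ineq)
    also have "\<dots> = norm (a 0) + cmod l * (\<Sum>k<m. norm (a k)) + (\<Sum>k<m. norm (y k))"
      by (simp add: sum.distrib sum_distrib_left)
    also have "\<dots> \<le> norm (a 0) + cmod l * (\<Sum>k<m. norm (a k)) + Y"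
      unfolding Y_def by (intro add_left_mono sum_le_suminf y) auto
    finally have "(1 - cmod l) * (\<Sum>k<m. norm (a k)) \<le> norm (a 0) + Y"
      by (simp add: algebra_simps)
    then show ?thesis using assms(1) by (simp add: field_simps)
  qed
  show ?thesis
    by (rule summableI_nonneg_bounded[where x = "(norm (a 0) + Y) / (1 - cmod l)"]) (use le in auto)
qed

text \<open>Induction on the degree: write \<open>p = (X - z) q\<close>. If \<open>|z| < 1\<close>, then \<open>q\<close> annihilates
  \<open>y = M v - z v\<close>, whose orbit is summable by induction and drives the orbit of \<open>v\<close> through a
  contracting recursion. Otherwise \<open>z\<close> is no eigenvalue, so that \<open>q\<close> already annihilates \<open>v\<close>.\<close>
lemma summable_orbit_of_annihilated:
  fixes M :: "complex^'n^'n"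
  assumes M: "\<And>l u. u \<noteq> 0 \<Longrightarrow> M *v u = l *s u \<Longrightarrow> cmod l < 1"
  shows "p \<noteq> 0 \<Longrightarrow> poly_act M p v = 0 \<Longrightarrow> summable (\<lambda>k. norm (((*v) M ^^ k) v))"
proof (induction "degree p" arbitrary: p v)
  case 0
  then obtain c where "p = [:c:]" "c \<noteq> 0"
    by (metis degree_eq_zeroE pCons_0_0)
  with 0 have v: "v = 0" by simp
  have "((*v) M ^^ k) v = 0" for k
    by (induction k) (simp_all add: v)
  then show ?case by simp
next
  case (Suc d)
  then have "\<not> constant (poly p)" by (simp add: constant_degree)
  then obtain z where "poly p z = 0"
    using fundamental_theorem_of_algebra by blast
  then obtain q where pq: "p = [:-z, 1:] * q"
    by (metis dvdE poly_eq_0_iff_dvd)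
  with Suc have q: "q \<noteq> 0" by auto
  have "degree p = Suc (degree q)"
    unfolding pq using q by (subst degree_mult_eq) auto
  with Suc(2) have deg: "degree q = d" by simp
  have ann: "M *v poly_act M q v - z *s poly_act M q v = 0"
    using Suc pq by (simp only: poly_act_linear_factor)
  show ?case
  proof (cases "cmod z < 1")
    case True
    define y where "y = M *v v - z *s v"
    have "poly_act M q y = 0"
      using ann by (simp add: y_def poly_act_diff_arg poly_act_apply_commute poly_act_scale_arg)
    then have "summable (\<lambda>k. norm (((*v) M ^^ k) y))"
      using Suc(1) deg q by blast
    moreover have "((*v) M ^^ Suc k) v = z *s ((*v) M ^^ k) v + ((*v) M ^^ k) y" for k
    proof (induction k)
      case (Suc k)
      have "((*v) M ^^ Suc (Suc k)) v = M *v ((*v) M ^^ Suc k) v" by simp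
      also have "\<dots> = M *v (z *s ((*v) M ^^ k) v + ((*v) M ^^ k) y)"
        by (simp only: Suc)
      finally show ?case
        by (simp only: matrix_vector_right_distrib vector_scalar_commute) simp
    qed (simp add: y_def)
    ultimately show ?thesis
      by (rule summable_norm_contracting_recursion[OF True, rotated])
  next
    case False
    then have "poly_act M q v = 0"
      using ann M[of "poly_act M q v" z] by auto
    then show ?thesis using Suc(1) deg q by blast
  qed
qed

text \<open>Summability along every single orbit becomes a bound that is uniform in \<open>v\<close> by
  expanding \<open>v\<close> in the standard basis.\<close>
lemma strictly_stable_summable_powers:
  fixes M :: "real^'n^'n"
  assumes "strictly_stable M"
  obtains c where "summable c" "\<And>k. 0 \<le> c k" "\<And>k v. norm (((*v) M ^^ k) v) \<le> c k * norm v"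
proof
  define C :: "complex^'n^'n" where "C = (\<chi> i j. complex_of_real (M $ i $ j))"
  define emb :: "real^'n \<Rightarrow> complex^'n" where "emb = (\<lambda>v. \<chi> i. complex_of_real (v $ i))"
  have emb: "((*v) C ^^ k) (emb v) = emb (((*v) M ^^ k) v)" for k v
    by (induction k) (simp_all add: C_def emb_def matrix_vector_mult_def)
  have norm_emb: "norm (emb v) = norm v" for v
    by (simp add: emb_def norm_vec_def)
  have sm: "summable (\<lambda>k. norm (((*v) M ^^ k) v))" for v
  proof -
    obtain p where "p \<noteq> 0" "poly_act C p (emb v) = 0"
      using exists_annihilating_poly by blast
    then have "summable (\<lambda>k. norm (((*v) C ^^ k) (emb v)))"
      by (rule summable_orbit_of_annihilated[rotated])
        (use assms in \<open>auto simp: strictly_stable_def eigenvalues_def C_def\<close>)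
    then show ?thesis by (simp add: emb norm_emb)
  qed
  define c where "c k = (\<Sum>i\<in>UNIV. norm (((*v) M ^^ k) (axis i 1)))" for k
  show "summable c"
    unfolding c_def by (intro summable_sum sm)
  show "0 \<le> c k" for k
    by (simp add: c_def sum_nonneg)
  show "norm (((*v) M ^^ k) v) \<le> c k * norm v" for k v
  proof -
    have lin: "linear ((*v) M ^^ k)"
      proof (induction k)
        case (Suc k)
        then show ?case
          by (simp only: funpow.simps) (rule linear_compose[OF _ matrix_vector_mul_linear])
      qed (simp add: linear_iff)
    have "((*v) M ^^ k) v = ((*v) M ^^ k) (\<Sum>i\<in>UNIV. v $ i *\<^sub>R axis i 1)"
      using basis_expansion[of v] by (simp add: scalar_mult_eq_scaleR)
    also have "\<dots> = (\<Sum>i\<in>UNIV. v $ i *\<^sub>R ((*v) M ^^ k) (axis i 1))"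
      by (simp add: linear_sum[OF lin] linear_scale[OF lin])
    also have "norm \<dots> \<le> (\<Sum>i\<in>UNIV. norm (((*v) M ^^ k) (axis i 1)) * norm v)"
      by (rule sum_norm_le) (metis norm_scaleR real_norm_def mult.commute mult_right_mono component_le_norm_cart norm_ge_zero)
    finally show ?thesis by (simp add: c_def sum_distrib_right)
  qed
qed

section \<open>The linear recursion driven by independent noise\<close>

text \<open>The indicator of a closed set \<open>C\<close> is the decreasing limit of the bounded continuous functions
  \<open>max 0 (1 - n * infdist x C)\<close>, so the integrals determine the measures on closed sets.\<close>
lemma borel_prob_eqI_bounded_continuous:
  fixes \<mu> \<nu> :: "'a::metric_space measure"
  assumes \<mu>: "prob_space \<mu>" "sets \<mu> = sets borel" and \<nu>: "prob_space \<nu>" "sets \<nu> = sets borel"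
    and eq: "\<And>f :: 'a \<Rightarrow> real. continuous_on UNIV f \<Longrightarrow> bounded (range f) \<Longrightarrow>
      (\<integral>x. f x \<partial>\<mu>) = (\<integral>x. f x \<partial>\<nu>)"
  shows "\<mu> = \<nu>"
proof -
  have lim: "(\<lambda>n. \<integral>x. max 0 (1 - real n * infdist x C) \<partial>\<rho>) \<longlonglongrightarrow> measure \<rho> C"
    if \<rho>: "prob_space \<rho>" "sets \<rho> = sets borel" and C: "closed C" "C \<noteq> {}"
    for \<rho> :: "'a measure" and C
  proof -
    interpret prob_space \<rho> by fact
    note [measurable_cong] = \<rho>(2)
    have sp: "space \<rho> = UNIV" using sets_eq_imp_space_eq[OF \<rho>(2)] by simp
    have [measurable]: "C \<in> sets \<rho>" using \<rho> C by simp
    have "(\<lambda>n. \<integral>x. max 0 (1 - real n * infdist x C) \<partial>\<rho>) \<longlonglongrightarrow> (\<integral>x. indicator C x \<partial>\<rho>)"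
    proof (rule integral_dominated_convergence[where w = "\<lambda>_. 1"])
      show "(\<lambda>x. max 0 (1 - real n * infdist x C)) \<in> borel_measurable \<rho>" for n
        unfolding measurable_cong_sets[OF \<rho>(2) refl]
        by (intro borel_measurable_continuous_onI continuous_intros)
      show "AE x in \<rho>. (\<lambda>n. max 0 (1 - real n * infdist x C)) \<longlonglongrightarrow> indicator C x"
      proof (rule AE_I2)
        fix x
        show "(\<lambda>n. max 0 (1 - real n * infdist x C)) \<longlonglongrightarrow> indicator C x"
        proof (cases "x \<in> C")
          case False
          then have pos: "infdist x C > 0"
            using C infdist_pos_not_in_closed by blast
          then obtain n0 where "1 < real n0 * infdist x C"
            using reals_Archimedean3 by blast
          moreover have "real n0 * infdist x C \<le> real n * infdist x C" if "n \<ge> n0" for n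
            using that pos by (intro mult_right_mono) auto
          ultimately have "max 0 (1 - real n * infdist x C) = 0" if "n \<ge> n0" for n
            using that by fastforce
          then show ?thesis
            using False by (auto intro!: tendsto_eventually eventually_sequentiallyI[of n0])
        qed simp
      qed
    qed (auto simp: infdist_nonneg)
    then show ?thesis by (simp add: sp)
  qed
  show ?thesis
  proof (rule measure_eqI_generator_eq[where E = "Collect closed" and \<Omega> = UNIV and A = "\<lambda>_. UNIV"])
    interpret m: prob_space \<mu> by fact
    interpret n: prob_space \<nu> by fact
    show "emeasure \<mu> C = emeasure \<nu> C" if "C \<in> Collect closed" for C
    proof (cases "C = {}")
      case False
      have "(\<integral>x. max 0 (1 - real n * infdist x C) \<partial>\<mu>) = (\<integral>x. max 0 (1 - real n * infdist x C) \<partial>\<nu>)" for n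
        by (rule eq) (auto intro!: continuous_intros boundedI[where B = 1] simp: infdist_nonneg)
      then have "measure \<mu> C = measure \<nu> C"
        using LIMSEQ_unique lim[OF \<mu>, of C] lim[OF \<nu>, of C] that False by fastforce
      then show ?thesis by (simp add: m.emeasure_eq_measure n.emeasure_eq_measure)
    qed simp
    show "emeasure \<mu> UNIV \<noteq> \<infinity>" by simp
    show "sets \<mu> = sigma_sets UNIV (Collect closed)" "sets \<nu> = sigma_sets UNIV (Collect closed)"
      using \<mu>(2) \<nu>(2) by (simp_all add: borel_eq_closed)
  qed (auto simp: Int_stable_def)
qed

text \<open>The recursion \<open>s\<^sup>+ = G s + w\<close> with \<open>w\<close> of law \<open>\<omega>\<close>. The finite first moment makes
  the noise series converge almost surely.\<close>
locale stable_noise =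
  fixes G :: "real^'n^'n" and \<omega> :: "(real^'n) measure"
  assumes stable: "strictly_stable G"
    and prob_noise: "prob_space \<omega>"
    and sets_noise [measurable_cong, simp]: "sets \<omega> = sets borel"
    and integrable_noise: "integrable \<omega> (\<lambda>x. norm x)"
begin

sublocale noise: sequence_space \<omega>
  using prob_noise
  by (simp add: sequence_space_def product_prob_space_def product_prob_space_axioms_def
      product_sigma_finite_def prob_space_imp_sigma_finite)

abbreviation pow :: "nat \<Rightarrow> real^'n \<Rightarrow> real^'n" where
  "pow k \<equiv> (*v) G ^^ k"

text \<open>The accumulated noise after \<open>k\<close> steps, with the noise variables in reversed order: the most
  recent one carries index \<open>0\<close>.\<close>
definition noise_sum :: "nat \<Rightarrow> (nat \<Rightarrow> real^'n) \<Rightarrow> real^'n" where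
  "noise_sum k \<xi> = (\<Sum>j<k. pow j (\<xi> j))"

definition noise_limit :: "(nat \<Rightarrow> real^'n) \<Rightarrow> real^'n" where
  "noise_limit \<xi> = (\<Sum>j. pow j (\<xi> j))"

definition step_law :: "(real^'n) measure \<Rightarrow> (real^'n) measure" where
  "step_law \<nu> = distr (\<nu> \<Otimes>\<^sub>M \<omega>) borel (\<lambda>(s, w). G *v s + w)"

definition limit_law :: "(real^'n) measure" where
  "limit_law = distr noise.S borel noise_limit"

lemma measurable_matrix [measurable]: "(*v) G \<in> borel_measurable borel"
  by (intro borel_measurable_continuous_onI continuous_intros)

lemma measurable_pow [measurable]: "pow k \<in> borel_measurable borel"
proof (induction k)
  case (Suc k)
  note [measurable] = Suc
  show ?case by simp
qed simp

lemma measurable_noise_component: "(\<lambda>\<xi>. \<xi> j) \<in> borel_measurable noise.S"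
proof -
  have "(\<lambda>\<xi>. \<xi> j) \<in> noise.S \<rightarrow>\<^sub>M \<omega>" by simp
  then show ?thesis by (simp cong: measurable_cong_sets)
qed

lemma measurable_noise_sum [measurable]: "noise_sum k \<in> borel_measurable noise.S"
  unfolding noise_sum_def[abs_def]
  by (intro borel_measurable_sum measurable_compose[OF measurable_noise_component measurable_pow])

lemma measurable_noise_limit [measurable]: "noise_limit \<in> borel_measurable noise.S"
  unfolding noise_limit_def[abs_def]
  by (intro borel_measurable_suminf measurable_compose[OF measurable_noise_component measurable_pow])

text \<open>The series \<open>\<Sum>j. c\<^sub>j \<parallel>\<xi>\<^sub>j\<parallel>\<close> has the finite expectation \<open>(\<Sum>j. c\<^sub>j) E\<parallel>\<xi>\<^sub>0\<parallel>\<close>, hence is finite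
  almost surely.\<close>
lemma AE_summable_noise: "AE \<xi> in noise.S. summable (\<lambda>j. pow j (\<xi> j))"
proof -
  obtain c where c: "summable c" "\<And>k. 0 \<le> c k" "\<And>k v. norm (pow k v) \<le> c k * norm v"
    using strictly_stable_summable_powers[OF stable] by metis
  define m where "m = (\<integral>x. norm x \<partial>\<omega>)"
  have m: "0 \<le> m" by (simp add: m_def)
  have [measurable]: "(\<lambda>\<xi>. norm (\<xi> j)) \<in> borel_measurable noise.S" for j
    by (rule measurable_compose[OF measurable_noise_component borel_measurable_norm])
  have mom: "(\<integral>\<^sup>+\<xi>. ennreal (norm (\<xi> j)) \<partial>noise.S) = ennreal m" for j
  proof -
    have "(\<integral>\<^sup>+\<xi>. ennreal (norm (\<xi> j)) \<partial>noise.S)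
        = (\<integral>\<^sup>+x. ennreal (norm x) \<partial>distr noise.S \<omega> (\<lambda>\<xi>. \<xi> j))"
      by (subst nn_integral_distr) auto
    also have "\<dots> = ennreal m"
      unfolding m_def by (subst noise.PiM_component)
        (auto intro!: nn_integral_eq_integral integrable_noise)
    finally show ?thesis .
  qed
  have "(\<integral>\<^sup>+\<xi>. (\<Sum>j. ennreal (c j * norm (\<xi> j))) \<partial>noise.S)
      = (\<Sum>j. \<integral>\<^sup>+\<xi>. ennreal (c j * norm (\<xi> j)) \<partial>noise.S)"
    by (rule nn_integral_suminf) measurable
  also have "\<dots> = (\<Sum>j. ennreal (c j * m))"
    using c(2) m by (simp add: ennreal_mult nn_integral_cmult mom)
  also have "\<dots> = ennreal (\<Sum>j. c j * m)"
    using c m by (intro suminf_ennreal2) (auto intro: summable_mult2)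
  finally have "(\<integral>\<^sup>+\<xi>. (\<Sum>j. ennreal (c j * norm (\<xi> j))) \<partial>noise.S) \<noteq> \<infinity>" by simp
  then have "AE \<xi> in noise.S. (\<Sum>j. ennreal (c j * norm (\<xi> j))) \<noteq> \<infinity>"
    by (intro nn_integral_PInf_AE) measurable
  then show ?thesis
  proof eventually_elim
    case (elim \<xi>)
    then have "summable (\<lambda>j. c j * norm (\<xi> j))"
      using c(2) by (intro summable_suminf_not_top) auto
    then show ?case
      by (rule summable_comparison_test[OF exI[of _ 0], rotated]) (use c(3) in auto)
  qed
qed

lemma noise_sum_case_nat: "noise_sum (Suc k) (case_nat x \<xi>) = x + G *v noise_sum k \<xi>"
  unfolding noise_sum_def sum.lessThan_Suc_shift
  by (simp add: linear_sum[OF matrix_vector_mul_linear])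

lemma noise_limit_case_nat:
  assumes "summable (\<lambda>j. pow j (\<xi> j))"
  shows "noise_limit (case_nat x \<xi>) = x + G *v noise_limit \<xi>"
proof -
  have bl: "bounded_linear ((*v) G)" by (rule matrix_vector_mul_bounded_linear)
  have "(\<lambda>j. G *v pow j (\<xi> j)) sums (G *v noise_limit \<xi>)"
    unfolding noise_limit_def by (intro bounded_linear.sums[OF bl] summable_sums assms)
  then have "(\<lambda>j. pow (Suc j) (case_nat x \<xi> (Suc j))) sums (G *v noise_limit \<xi>)" by simp
  then have "(\<lambda>j. pow j (case_nat x \<xi> j)) sums (G *v noise_limit \<xi> + pow 0 (case_nat x \<xi> 0))"
    by (rule sums_Suc)
  then show ?thesis by (simp add: noise_limit_def sums_iff add.commute)
qed

text \<open>An i.i.d. sequence prefixed with an independent variable of the same law is again such a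
  sequence. This replaces the exchange of noise variables both in the law of the iterates and in the
  stationarity of the limit.\<close>
lemma nn_integral_noise_shift:
  assumes [measurable]: "\<phi> \<in> borel_measurable noise.S"
  shows "(\<integral>\<^sup>+\<xi>. \<integral>\<^sup>+x. \<phi> (case_nat x \<xi>) \<partial>\<omega> \<partial>noise.S) = (\<integral>\<^sup>+\<xi>. \<phi> \<xi> \<partial>noise.S)"
proof -
  interpret pair_sigma_finite \<omega> noise.S
    by (intro pair_sigma_finite.intro prob_space_imp_sigma_finite prob_noise noise.P.prob_space_axioms)
  have "(\<integral>\<^sup>+\<xi>. \<phi> \<xi> \<partial>noise.S) = (\<integral>\<^sup>+\<xi>. \<phi> \<xi> \<partial>distr (\<omega> \<Otimes>\<^sub>M noise.S) noise.S (\<lambda>(s, \<omega>). case_nat s \<omega>))"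
    by (simp only: noise.PiM_iter)
  also have "\<dots> = (\<integral>\<^sup>+z. \<phi> (case z of (s, \<xi>) \<Rightarrow> case_nat s \<xi>) \<partial>(\<omega> \<Otimes>\<^sub>M noise.S))"
    by (rule nn_integral_distr) measurable
  also have "\<dots> = (\<integral>\<^sup>+\<xi>. \<integral>\<^sup>+x. \<phi> (case_nat x \<xi>) \<partial>\<omega> \<partial>noise.S)"
    by (subst nn_integral_snd[symmetric]) (auto simp: case_prod_beta)
  finally show ?thesis ..
qed

lemma nn_integral_step_law:
  assumes \<nu> [measurable_cong]: "sets \<nu> = sets borel" and [measurable]: "\<phi> \<in> borel_measurable borel"
  shows "(\<integral>\<^sup>+s. \<phi> s \<partial>step_law \<nu>) = (\<integral>\<^sup>+s. \<integral>\<^sup>+x. \<phi> (G *v s + x) \<partial>\<omega> \<partial>\<nu>)"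
proof -
  have "(\<integral>\<^sup>+s. \<phi> s \<partial>step_law \<nu>) = (\<integral>\<^sup>+z. \<phi> (case z of (s, w) \<Rightarrow> G *v s + w) \<partial>(\<nu> \<Otimes>\<^sub>M \<omega>))"
    unfolding step_law_def by (rule nn_integral_distr) measurable
  also have "\<dots> = (\<integral>\<^sup>+s. \<integral>\<^sup>+x. \<phi> (G *v s + x) \<partial>\<omega> \<partial>\<nu>)"
    by (subst sigma_finite_measure.nn_integral_fst[OF prob_space_imp_sigma_finite[OF prob_noise], symmetric])
      (auto simp: case_prod_beta)
  finally show ?thesis .
qed

lemma sets_step_law [simp, measurable_cong]: "sets (step_law \<nu>) = sets borel"
  by (simp add: step_law_def)

lemma sets_iterate_step_law [measurable_cong]:
  "sets \<nu> = sets borel \<Longrightarrow> sets ((step_law ^^ k) \<nu>) = sets borel"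
  by (cases k) simp_all

lemma nn_integral_iterate_step_law:
  assumes \<nu> [measurable_cong]: "sets \<nu> = sets borel" "prob_space \<nu>"
    and "\<phi> \<in> borel_measurable borel"
  shows "(\<integral>\<^sup>+s. \<phi> s \<partial>(step_law ^^ k) \<nu>) =
    (\<integral>\<^sup>+s. \<integral>\<^sup>+\<xi>. \<phi> (pow k s + noise_sum k \<xi>) \<partial>noise.S \<partial>\<nu>)"
  using assms(3)
proof (induction k arbitrary: \<phi>)
  case 0
  then show ?case by (simp add: noise_sum_def noise.P.emeasure_space_1)
next
  case (Suc k)
  note [measurable] = Suc.prems
  have "(\<integral>\<^sup>+s. \<phi> s \<partial>(step_law ^^ Suc k) \<nu>) =
      (\<integral>\<^sup>+s. \<integral>\<^sup>+x. \<phi> (G *v s + x) \<partial>\<omega> \<partial>(step_law ^^ k) \<nu>)"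
    by (simp add: nn_integral_step_law sets_iterate_step_law \<nu>)
  also have "\<dots> = (\<integral>\<^sup>+s. \<integral>\<^sup>+\<xi>. \<integral>\<^sup>+x. \<phi> (G *v (pow k s + noise_sum k \<xi>) + x) \<partial>\<omega> \<partial>noise.S \<partial>\<nu>)"
    by (rule Suc.IH) measurable
  also have "\<dots> = (\<integral>\<^sup>+s. \<integral>\<^sup>+\<xi>. \<integral>\<^sup>+x. \<phi> (pow (Suc k) s + noise_sum (Suc k) (case_nat x \<xi>)) \<partial>\<omega> \<partial>noise.S \<partial>\<nu>)"
    by (simp add: noise_sum_case_nat matrix_vector_right_distrib ac_simps)
  also have "\<dots> = (\<integral>\<^sup>+s. \<integral>\<^sup>+\<xi>. \<phi> (pow (Suc k) s + noise_sum (Suc k) \<xi>) \<partial>noise.S \<partial>\<nu>)"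
    by (intro nn_integral_cong nn_integral_noise_shift) measurable
  finally show ?case .
qed

text \<open>This realises the laws for all \<open>k\<close> on one probability space, on which the accumulated
  noise converges almost surely.\<close>
lemma iterate_step_law:
  assumes \<nu> [measurable_cong]: "sets \<nu> = sets borel" "prob_space \<nu>"
  shows "(step_law ^^ k) \<nu> =
    distr (\<nu> \<Otimes>\<^sub>M noise.S) borel (\<lambda>(s, \<xi>). pow k s + noise_sum k \<xi>)"
proof (rule measure_eqI)
  show "sets ((step_law ^^ k) \<nu>) = sets (distr (\<nu> \<Otimes>\<^sub>M noise.S) borel (\<lambda>(s, \<xi>). pow k s + noise_sum k \<xi>))"
    by (simp add: sets_iterate_step_law \<nu>)
  fix E assume "E \<in> sets ((step_law ^^ k) \<nu>)"
  then have E [measurable]: "E \<in> sets borel" by (simp add: sets_iterate_step_law \<nu>)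
  have "emeasure ((step_law ^^ k) \<nu>) E = (\<integral>\<^sup>+s. indicator E s \<partial>(step_law ^^ k) \<nu>)"
    by (simp add: sets_iterate_step_law \<nu>)
  also have "\<dots> = (\<integral>\<^sup>+s. \<integral>\<^sup>+\<xi>. indicator E (pow k s + noise_sum k \<xi>) \<partial>noise.S \<partial>\<nu>)"
    by (rule nn_integral_iterate_step_law[OF \<nu>]) simp
  also have "\<dots> = (\<integral>\<^sup>+z. indicator E (case z of (s, \<xi>) \<Rightarrow> pow k s + noise_sum k \<xi>) \<partial>(\<nu> \<Otimes>\<^sub>M noise.S))"
    by (subst noise.P.nn_integral_fst[symmetric]) (auto simp: case_prod_beta)
  also have "\<dots> = (\<integral>\<^sup>+z. indicator E z \<partial>distr (\<nu> \<Otimes>\<^sub>M noise.S) borel (\<lambda>(s, \<xi>). pow k s + noise_sum k \<xi>))"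
    by (rule nn_integral_distr[symmetric]) measurable
  finally show "emeasure ((step_law ^^ k) \<nu>) E =
      emeasure (distr (\<nu> \<Otimes>\<^sub>M noise.S) borel (\<lambda>(s, \<xi>). pow k s + noise_sum k \<xi>)) E"
    by simp
qed

lemma stationary_limit_law: "stationary_law G \<omega> limit_law"
proof -
  have sets: "sets limit_law = sets borel" by (simp add: limit_law_def)
  have prob: "prob_space limit_law"
    unfolding limit_law_def by (rule noise.P.prob_space_distr) measurable
  have "step_law limit_law = limit_law"
  proof (rule measure_eqI)
    show "sets (step_law limit_law) = sets limit_law" by (simp add: sets)
    fix E assume "E \<in> sets (step_law limit_law)"
    then have [measurable]: "E \<in> sets borel" by simp
    have "emeasure (step_law limit_law) E = (\<integral>\<^sup>+s. indicator E s \<partial>step_law limit_law)" by simp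
    also have "\<dots> = (\<integral>\<^sup>+s. \<integral>\<^sup>+x. indicator E (G *v s + x) \<partial>\<omega> \<partial>limit_law)"
      by (rule nn_integral_step_law[OF sets]) simp
    also have "\<dots> = (\<integral>\<^sup>+\<xi>. \<integral>\<^sup>+x. indicator E (G *v noise_limit \<xi> + x) \<partial>\<omega> \<partial>noise.S)"
      unfolding limit_law_def by (rule nn_integral_distr) measurable
    also have "\<dots> = (\<integral>\<^sup>+\<xi>. \<integral>\<^sup>+x. indicator E (noise_limit (case_nat x \<xi>)) \<partial>\<omega> \<partial>noise.S)"
      by (rule nn_integral_cong_AE)
        (use AE_summable_noise in eventually_elim, simp add: noise_limit_case_nat add.commute)
    also have "\<dots> = (\<integral>\<^sup>+\<xi>. indicator E (noise_limit \<xi>) \<partial>noise.S)"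
      by (rule nn_integral_noise_shift) measurable
    also have "\<dots> = (\<integral>\<^sup>+s. indicator E s \<partial>limit_law)"
      unfolding limit_law_def by (rule nn_integral_distr[symmetric]) measurable
    also have "\<dots> = emeasure limit_law E" by (simp add: sets)
    finally show "emeasure (step_law limit_law) E = emeasure limit_law E" .
  qed
  then show ?thesis by (simp add: stationary_law_def step_law_def sets prob)
qed

text \<open>The deterministic shift \<open>d\<close> stands for the nominal state, which separates the real state from
  the error.\<close>
lemma shifted_iterates_converge:
  fixes f :: "real^'n \<Rightarrow> real"
  assumes \<nu> [measurable_cong]: "sets \<nu> = sets borel" "prob_space \<nu>"
    and f: "continuous_on UNIV f" "bounded (range f)" and d: "d \<longlonglongrightarrow> 0"
  shows "(\<lambda>k. \<integral>s. f (d k + s) \<partial>(step_law ^^ k) \<nu>) \<longlonglongrightarrow> (\<integral>s. f s \<partial>limit_law)"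
proof -
  interpret \<nu>: prob_space \<nu> by fact
  interpret pair_prob_space \<nu> noise.S ..
  obtain b where b: "\<And>x. norm (f x) \<le> b"
    using f(2) by (auto simp: bounded_iff)
  have [measurable]: "f \<in> borel_measurable borel"
    by (rule borel_measurable_continuous_onI[OF f(1)])
  obtain c where c: "summable c" "\<And>k v. norm (pow k v) \<le> c k * norm v"
    using strictly_stable_summable_powers[OF stable] by metis
  have pow0: "(\<lambda>k. pow k s) \<longlonglongrightarrow> 0" for s
  proof (rule Lim_null_comparison)
    show "\<forall>\<^sub>F k in sequentially. norm (pow k s) \<le> c k * norm s" using c(2) by simp
    show "(\<lambda>k. c k * norm s) \<longlonglongrightarrow> 0"
      using tendsto_mult_right[OF summable_LIMSEQ_zero[OF c(1)], of "norm s"] by simp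
  qed
  have snd: "distr (\<nu> \<Otimes>\<^sub>M noise.S) noise.S snd = noise.S"
  proof (rule measure_eqI)
    fix E assume "E \<in> sets (distr (\<nu> \<Otimes>\<^sub>M noise.S) noise.S snd)"
    then have E: "E \<in> sets noise.S" by simp
    have "snd -` E \<inter> space (\<nu> \<Otimes>\<^sub>M noise.S) = space \<nu> \<times> E"
      using sets.sets_into_space[OF E] by (auto simp: space_pair_measure)
    then show "emeasure (distr (\<nu> \<Otimes>\<^sub>M noise.S) noise.S snd) E = emeasure noise.S E"
      using E by (simp add: emeasure_distr noise.P.emeasure_pair_measure_Times \<nu>.emeasure_space_1)
  qed simp
  have "AE z in \<nu> \<Otimes>\<^sub>M noise.S. summable (\<lambda>j. pow j (snd z j))"
    by (rule AE_distrD[OF measurable_snd, where P = "\<lambda>\<xi>. summable (\<lambda>j. pow j (\<xi> j))"])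
      (subst snd, rule AE_summable_noise)
  then have lim: "AE z in \<nu> \<Otimes>\<^sub>M noise.S.
      (\<lambda>k. f (d k + (pow k (fst z) + noise_sum k (snd z)))) \<longlonglongrightarrow> f (noise_limit (snd z))"
  proof eventually_elim
    case (elim z)
    have "(\<lambda>k. noise_sum k (snd z)) \<longlonglongrightarrow> noise_limit (snd z)"
      using summable_LIMSEQ[OF elim] by (simp add: noise_sum_def noise_limit_def)
    then have "(\<lambda>k. d k + (pow k (fst z) + noise_sum k (snd z))) \<longlonglongrightarrow> 0 + (0 + noise_limit (snd z))"
      by (intro tendsto_add d pow0)
    then show ?case
      using continuous_on_tendsto_compose[OF f(1)] by fastforce
  qed
  have "(\<lambda>k. \<integral>z. f (d k + (pow k (fst z) + noise_sum k (snd z))) \<partial>(\<nu> \<Otimes>\<^sub>M noise.S))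
      \<longlonglongrightarrow> (\<integral>z. f (noise_limit (snd z)) \<partial>(\<nu> \<Otimes>\<^sub>M noise.S))"
    by (rule integral_dominated_convergence[where w = "\<lambda>_. b"]) (use lim b in auto)
  moreover have "(\<integral>s. f (d k + s) \<partial>(step_law ^^ k) \<nu>) =
      (\<integral>z. f (d k + (pow k (fst z) + noise_sum k (snd z))) \<partial>(\<nu> \<Otimes>\<^sub>M noise.S))" for k
    unfolding iterate_step_law[OF \<nu>]
    by (subst integral_distr) (auto simp: case_prod_beta)
  moreover have "(\<integral>z. f (noise_limit (snd z)) \<partial>(\<nu> \<Otimes>\<^sub>M noise.S)) = (\<integral>s. f s \<partial>limit_law)"
  proof -
    have "(\<integral>z. f (noise_limit (snd z)) \<partial>(\<nu> \<Otimes>\<^sub>M noise.S)) =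
        (\<integral>\<xi>. f (noise_limit \<xi>) \<partial>distr (\<nu> \<Otimes>\<^sub>M noise.S) noise.S snd)"
      by (rule integral_distr[symmetric]) measurable
    also have "\<dots> = (\<integral>s. f s \<partial>limit_law)"
      unfolding snd limit_law_def by (rule integral_distr[symmetric]) measurable
    finally show ?thesis .
  qed
  ultimately show ?thesis by simp
qed

lemma stationary_law_unique:
  assumes "stationary_law G \<omega> \<rho>"
  shows "\<rho> = limit_law"
proof -
  have \<rho>: "prob_space \<rho>" "sets \<rho> = sets borel" and "step_law \<rho> = \<rho>"
    using assms by (auto simp: stationary_law_def step_law_def)
  then have fixed: "(step_law ^^ k) \<rho> = \<rho>" for k
    by (induction k) simp_all
  show ?thesis
  proof (rule borel_prob_eqI_bounded_continuous[OF \<rho>])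
    show "prob_space limit_law" "sets limit_law = sets borel"
      using stationary_limit_law by (auto simp: stationary_law_def)
    fix f :: "real^'n \<Rightarrow> real"
    assume "continuous_on UNIV f" "bounded (range f)"
    from shifted_iterates_converge[OF \<rho>(2,1) this tendsto_const] fixed
    show "(\<integral>x. f x \<partial>\<rho>) = (\<integral>x. f x \<partial>limit_law)"
      by (simp add: LIMSEQ_const_iff)
  qed
qed

lemma ex1_stationary_law: "\<exists>!\<rho>. stationary_law G \<omega> \<rho>"
  using stationary_limit_law stationary_law_unique by blast

end

text \<open>The nominal state is deterministic, so the error is a function of the real state and as
  such independent of the current noise. Its laws are therefore the iterates of
  \<open>step_law\<close>.\<close>
lemma (in stable_noise) tube_state_converges:
  fixes B :: "real^'m^'n" and K :: "real^'n^'m"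
  assumes M: "prob_space M" and w: "\<And>k. distr M borel (w k) = \<omega>"
    and G: "G = A + B ** K"
    and z: "\<And>k. z (Suc k) = A *v z k + B *v \<kappa> (z k)" "z \<longlonglongrightarrow> 0"
    and x: "closed_loop_process M w A B (\<lambda>k. tube_feedback \<kappa> K (z k)) x u"
  shows "converges_weakly (\<lambda>k. distr M borel (x k)) limit_law"
proof -
  interpret prob_space M by fact
  have ind: "independent_rvs M (w k) (\<lambda>a. (x k a, u k a))" for k
    using x by (simp add: closed_loop_process_def)
  have w_meas [measurable]: "w k \<in> borel_measurable M" for k
    using ind by (simp add: independent_rvs_def)
  have x_meas [measurable]: "x k \<in> borel_measurable M" for k
  proof -
    have "(\<lambda>a. (x k a, u k a)) \<in> borel_measurable M"
      using ind by (simp add: independent_rvs_def)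
    then have "(\<lambda>a. fst (x k a, u k a)) \<in> borel_measurable M"
      by (rule measurable_compose) (intro borel_measurable_continuous_onI continuous_intros)
    then show ?thesis by simp
  qed
  define s where "s k a = x k a - z k" for k a
  have s_meas [measurable]: "s k \<in> borel_measurable M" for k
    unfolding s_def by measurable
  have s_Suc: "s (Suc k) a = G *v s k a + w k a" if "a \<in> space M" for k a
    using x that z(1)[of k]
    by (simp add: closed_loop_process_def tube_feedback_def s_def G matrix_vector_mult_add_rdistrib
        matrix_vector_mul_assoc[symmetric] matrix_vector_right_distrib matrix_vector_mult_diff_distrib)
  have law_Suc: "distr M borel (s (Suc k)) = step_law (distr M borel (s k))" for k
  proof -
    let ?gen = "\<lambda>Y :: 'a \<Rightarrow> real^'n. {Y -` S \<inter> space M |S. S \<in> sets borel}"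
    \<comment> \<open>Independence from \<open>(x k, u k)\<close> passes to the error, which generates a smaller
      \<open>\<sigma>\<close>-algebra.\<close>
    have sub: "?gen (s k) \<subseteq> {(\<lambda>a. (x k a, u k a)) -` S \<inter> space M |S. S \<in> sets borel}"
    proof safe
      fix S :: "(real^'n) set" assume [measurable]: "S \<in> sets borel"
      have "(\<lambda>y. fst y - z k) \<in> borel_measurable (borel :: ((real^'n) \<times> (real^'m)) measure)"
        by (intro borel_measurable_continuous_onI continuous_intros)
      from measurable_sets[OF this \<open>S \<in> sets borel\<close>]
      show "\<exists>T. s k -` S \<inter> space M = (\<lambda>a. (x k a, u k a)) -` T \<inter> space M \<and> T \<in> sets borel"
        by (intro exI[of _ "(\<lambda>y. fst y - z k) -` S"]) (auto simp: s_def)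
    qed
    let ?xu = "{(\<lambda>a. (x k a, u k a)) -` S \<inter> space M |S. S \<in> sets borel}"
    have iws: "indep_set (?gen (w k)) ?xu"
      using ind[of k] by (simp add: independent_rvs_def)
    have iws': "?gen (w k) \<subseteq> events" "?xu \<subseteq> events"
      "\<And>S T. S \<in> ?gen (w k) \<Longrightarrow> T \<in> ?xu \<Longrightarrow> prob (S \<inter> T) = prob S * prob T"
      using iws[unfolded indep_sets2_eq] by blast+
    have "indep_set (?gen (s k)) (?gen (w k))"
      unfolding indep_sets2_eq
    proof (intro conjI ballI)
      show "?gen (s k) \<subseteq> events" using sub iws'(2) by (rule order.trans)
      show "?gen (w k) \<subseteq> events" by (rule iws'(1))
      fix S T assume S: "S \<in> ?gen (s k)" and T: "T \<in> ?gen (w k)"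
      have "prob (T \<inter> S) = prob T * prob S"
        by (rule iws'(3)[OF T subsetD[OF sub S]])
      then show "prob (S \<inter> T) = prob S * prob T"
        by (simp only: Int_commute mult.commute)
    qed
    then have "indep_sets (\<lambda>b. {case_bool (s k) (w k) b -` S \<inter> space M |S.
        S \<in> sets (case_bool borel borel b)}) UNIV"
      unfolding indep_set_def by (rule indep_sets_mono_sets) (simp split: bool.split)
    then have "indep_var borel (s k) borel (w k)"
      unfolding indep_var_def indep_vars_def2 by (simp split: bool.split)
    then have "distr M borel (s k) \<Otimes>\<^sub>M \<omega> = distr M (borel \<Otimes>\<^sub>M borel) (\<lambda>a. (s k a, w k a))"
      using indep_var_distribution_eq w by metis
    then have "step_law (distr M borel (s k)) =
        distr (distr M (borel \<Otimes>\<^sub>M borel) (\<lambda>a. (s k a, w k a))) borel (\<lambda>(s, w). G *v s + w)"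
      by (simp add: step_law_def)
    also have "\<dots> = distr M borel (\<lambda>a. G *v s k a + w k a)"
      by (subst distr_distr) (auto simp: comp_def)
    also have "\<dots> = distr M borel (s (Suc k))"
      by (rule distr_cong) (simp_all add: s_Suc)
    finally show ?thesis ..
  qed
  have law: "distr M borel (s k) = (step_law ^^ k) (distr M borel (s 0))" for k
    by (induction k) (simp_all add: law_Suc)
  show ?thesis
    unfolding converges_weakly_def
  proof (intro allI impI, elim conjE)
    fix f :: "real^'n \<Rightarrow> real"
    assume f: "continuous_on UNIV f" "bounded (range f)"
    have [measurable]: "f \<in> borel_measurable borel"
      by (rule borel_measurable_continuous_onI[OF f(1)])
    have "(\<lambda>k. \<integral>s. f (z k + s) \<partial>(step_law ^^ k) (distr M borel (s 0))) \<longlonglongrightarrow> (\<integral>s. f s \<partial>limit_law)"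
      by (rule shifted_iterates_converge[OF _ _ f z(2)]) (auto intro: prob_space_distr)
    moreover have "(\<integral>s. f (z k + s) \<partial>(step_law ^^ k) (distr M borel (s 0))) = (\<integral>y. f y \<partial>distr M borel (x k))" for k
      unfolding law[symmetric] by (simp add: integral_distr s_def)
    ultimately show "(\<lambda>k. \<integral>y. f y \<partial>distr M borel (x k)) \<longlonglongrightarrow> (\<integral>y. f y \<partial>limit_law)"
      by simp
  qed
qed

section \<open>Quadratic forms\<close>

lemma posdef_lower_bound:
  fixes M :: "real^'n^'n"
  assumes "posdef M"
  obtains c where "c > 0" "\<And>x. c * (norm x)\<^sup>2 \<le> x \<bullet> (M *v x)"
proof -
  have "continuous_on (sphere 0 1) (\<lambda>x. x \<bullet> (M *v x))"
    by (intro continuous_intros)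
  moreover have "axis undefined 1 \<in> sphere (0 :: real^'n) 1"
    by simp
  then have "sphere (0 :: real^'n) 1 \<noteq> {}"
    by blast
  ultimately obtain y where y: "y \<in> sphere 0 1" "\<And>x. x \<in> sphere 0 1 \<Longrightarrow> y \<bullet> (M *v y) \<le> x \<bullet> (M *v x)"
    using continuous_attains_inf[OF compact_sphere] by blast
  show ?thesis
  proof
    have "y \<noteq> 0" using y(1) by auto
    then show "y \<bullet> (M *v y) > 0"
      using assms by (simp add: posdef_def)
    show "y \<bullet> (M *v y) * (norm x)\<^sup>2 \<le> x \<bullet> (M *v x)" for x
    proof (cases "x = 0")
      case False
      then have "y \<bullet> (M *v y) \<le> (x /\<^sub>R norm x) \<bullet> (M *v (x /\<^sub>R norm x))"
        by (intro y(2)) simp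
      also have "\<dots> = (x \<bullet> (M *v x)) / (norm x)\<^sup>2"
        by (simp add: matrix_vector_mult_scaleR power2_eq_square divide_inverse)
      finally show ?thesis using False by (simp add: field_simps)
    qed simp
  qed
qed

lemma quadratic_form_upper_bound:
  fixes M :: "real^'n^'n"
  obtains c where "c > 0" "\<And>x. x \<bullet> (M *v x) \<le> c * (norm x)\<^sup>2"
proof -
  obtain c where c: "c > 0" "\<And>x. norm (M *v x) \<le> norm x * c"
    using bounded_linear.pos_bounded[OF matrix_vector_mul_bounded_linear] by blast
  have "x \<bullet> (M *v x) \<le> c * (norm x)\<^sup>2" for x
  proof -
    have "x \<bullet> (M *v x) \<le> norm x * norm (M *v x)" by (rule norm_cauchy_schwarz)
    also have "\<dots> \<le> norm x * (norm x * c)" by (intro mult_left_mono c) simp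
    finally show ?thesis by (simp add: power2_eq_square mult_ac)
  qed
  with c(1) show ?thesis using that by blast
qed

lemma posdef_nonneg: "posdef M \<Longrightarrow> 0 \<le> x \<bullet> (M *v x)"
  by (cases "x = 0") (auto simp: posdef_def less_imp_le)

text \<open>The parallelogram identity, as a quantitative form of strict convexity.\<close>
lemma quadratic_form_midpoint:
  fixes M :: "real^'n^'n"
  shows "((1/2) *\<^sub>R (x + y)) \<bullet> (M *v ((1/2) *\<^sub>R (x + y))) =
    (x \<bullet> (M *v x) + y \<bullet> (M *v y)) / 2 - ((x - y) \<bullet> (M *v (x - y))) / 4"
  by (simp add: matrix_vector_mult_scaleR matrix_vector_right_distrib matrix_vector_mult_diff_distrib
      inner_add_left inner_add_right inner_diff_left inner_diff_right field_simps)

section \<open>The maximal invariant set of a stable system\<close>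

text \<open>The states whose whole orbit stays in a small ball inside \<open>C\<close> form an invariant set, and
  bounded powers of \<open>G\<close> make it a neighbourhood of the origin.\<close>
lemma zero_interior_maximal_invariant:
  fixes G :: "real^'n^'n"
  assumes G: "strictly_stable G" and C: "0 \<in> interior C"
    and S: "maximal_positively_invariant ((*v) G) C S"
  shows "0 \<in> interior S"
proof -
  obtain c where c: "summable c" "\<And>k v. norm (((*v) G ^^ k) v) \<le> c k * norm v"
    using strictly_stable_summable_powers[OF G] by metis
  obtain b where b: "b > 0" "\<And>k. c k \<le> b"
    using summable_imp_Bseq[OF c(1)] unfolding Bseq_def by (metis abs_le_D1 real_norm_def)
  obtain e where e: "e > 0" "ball 0 e \<subseteq> C"
    using C by (meson mem_interior)
  define T where "T = {z. \<forall>k. norm (((*v) G ^^ k) z) < e}"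
  have "positively_invariant ((*v) G) C T"
    unfolding positively_invariant_def
  proof (intro conjI subsetI ballI)
    show "z \<in> C" if "z \<in> T" for z
    proof -
      have "norm (((*v) G ^^ 0) z) < e" using that unfolding T_def by blast
      then show ?thesis using e by auto
    qed
    show "G *v z \<in> T" if "z \<in> T" for z
      unfolding T_def
    proof safe
      fix k
      have "norm (((*v) G ^^ Suc k) z) < e" using that unfolding T_def by blast
      then show "norm (((*v) G ^^ k) (G *v z)) < e" by (simp add: funpow_swap1)
    qed
  qed
  then have "T \<subseteq> S" using S by (simp add: maximal_positively_invariant_def)
  moreover have "ball 0 (e / b) \<subseteq> T"
  proof
    fix z :: "real^'n" assume "z \<in> ball 0 (e / b)"
    then have z: "b * norm z < e" using b by (simp add: field_simps)
    have "norm (((*v) G ^^ k) z) \<le> b * norm z" for k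
      using c(2)[of k z] mult_right_mono[OF b(2)[of k], of "norm z"] by simp
    then show "z \<in> T" using z by (auto simp: T_def intro: le_less_trans)
  qed
  ultimately show ?thesis
    using b(1) e(1) by (meson mem_interior divide_pos_pos order.trans)
qed

section \<open>The nominal closed loop\<close>

locale nominal_mpc =
  fixes A :: "real^'n^'n" and B :: "real^'m^'n" and Z Zf :: "(real^'n) set" and V :: "(real^'m) set"
    and Q P :: "real^'n^'n" and R :: "real^'m^'m" and N :: nat and Kf :: "real^'n^'m"
  assumes closed_Z: "closed Z" and convex_Z: "convex Z"
    and compact_V: "compact V" and convex_V: "convex V"
    and closed_Zf: "closed Zf" and convex_Zf: "convex Zf"
    and posdef_P: "posdef P" and posdef_Q: "posdef Q" and posdef_R: "posdef R"
    and zero_interior: "0 \<in> interior Zf"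
    and Zf_subset: "Zf \<subseteq> Z"
    and terminal_control: "\<And>z. z \<in> Zf \<Longrightarrow> Kf *v z \<in> V"
    and terminal_invariant: "\<And>z. z \<in> Zf \<Longrightarrow> (A + B ** Kf) *v z \<in> Zf"
    and terminal_decrease: "\<And>z. z \<in> Zf \<Longrightarrow>
      terminal_cost P ((A + B ** Kf) *v z) + stage_cost Q R z (Kf *v z) \<le> terminal_cost P z"
    and horizon: "N \<ge> 1"
begin

abbreviation "admissible \<equiv> mpc_admissible A B Z V Zf N"
abbreviation "cost \<equiv> mpc_cost Q R P N"
abbreviation "minimizer \<equiv> mpc_minimizer A B Z V Zf Q R P N"
abbreviation "feasible \<equiv> mpc_feasible_set A B Z V Zf N"
abbreviation "stage \<equiv> stage_cost Q R"
abbreviation "law \<equiv> mpc_law A B Z V Zf Q R P N"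

lemma closed_loop_matrix: "(A + B ** Kf) *v z = A *v z + B *v (Kf *v z)"
  by (simp add: matrix_vector_mult_add_rdistrib matrix_vector_mul_assoc)

lemma stage_nonneg: "0 \<le> stage z v"
  by (simp add: stage_cost_def posdef_nonneg posdef_Q posdef_R)

lemma terminal_nonneg: "0 \<le> terminal_cost P z"
  by (simp add: terminal_cost_def posdef_nonneg posdef_P)

lemma cost_ge_first_stage: "stage (zs 0) (vs 0) \<le> cost zs vs"
proof -
  have "stage (zs 0) (vs 0) \<le> (\<Sum>t<N. stage (zs t) (vs t))"
    using horizon by (intro member_le_sum) (auto simp: stage_nonneg)
  then show ?thesis using terminal_nonneg by (simp add: mpc_cost_def add_increasing2)
qed

primrec traj :: "real^'n \<Rightarrow> (nat \<Rightarrow> real^'m) \<Rightarrow> nat \<Rightarrow> real^'n" where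
  "traj z vs 0 = z"
| "traj z vs (Suc t) = A *v traj z vs t + B *v vs t"

lemma traj_cong: "(\<And>i. i < t \<Longrightarrow> vs i = vs' i) \<Longrightarrow> traj z vs t = traj z vs' t"
  by (induction t) simp_all

lemma admissible_traj:
  assumes "admissible z zs vs" "t \<le> N"
  shows "zs t = traj z vs t"
  using assms(2) by (induction t) (use assms(1) in \<open>auto simp: mpc_admissible_def\<close>)

lemma cost_cong:
  assumes "\<And>t. t \<le> N \<Longrightarrow> zs t = zs' t" "\<And>t. t < N \<Longrightarrow> vs t = vs' t"
  shows "cost zs vs = cost zs' vs'"
  using assms by (simp add: mpc_cost_def)

lemma admissible_traj_iff:
  "admissible z (traj z vs) vs \<longleftrightarrow>
    (\<forall>t<N. vs t \<in> V) \<and> (\<forall>t. 1 \<le> t \<and> t < N \<longrightarrow> traj z vs t \<in> Z) \<and> traj z vs N \<in> Zf"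
  by (auto simp: mpc_admissible_def)

lemma continuous_traj: "continuous_on UNIV (\<lambda>vs. traj z vs t)"
proof (induction t)
  case (Suc t)
  have "continuous_on UNIV (\<lambda>vs :: nat \<Rightarrow> real^'m. B *v vs t)"
    by (rule continuous_on_compose2[where t = UNIV and g = "(*v) B"])
      (auto intro!: continuous_intros)
  with Suc show ?case
    by (auto intro!: continuous_intros continuous_on_compose2[where t = UNIV and g = "(*v) A"])
qed simp

lemma continuous_cost: "continuous_on UNIV (\<lambda>vs. cost (traj z vs) vs)"
  unfolding mpc_cost_def stage_cost_def terminal_cost_def
  by (intro continuous_intros continuous_traj continuous_on_product_coordinates
      continuous_on_compose2[where t = UNIV and g = "(*v) Q"]
      continuous_on_compose2[where t = UNIV and g = "(*v) P"]
      continuous_on_compose2[where t = UNIV and g = "(*v) R"]) auto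

text \<open>Sequences of controls in the compact set \<open>V\<close> form a compact set in the product topology, on
  which the trajectory, hence the cost and the state constraints, depend continuously.\<close>
lemma minimizer_exists:
  assumes "z \<in> feasible"
  obtains zs vs where "minimizer z zs vs"
proof -
  \<comment> \<open>Whole sequences, because \<open>nat \<Rightarrow> real^'m\<close> carries the product topology; the entries
    beyond the horizon only have to lie in \<open>V\<close>.\<close>
  define D where "D = {vs. (\<forall>t. vs t \<in> V) \<and> (\<forall>t\<in>{1..<N}. traj z vs t \<in> Z) \<and> traj z vs N \<in> Zf}"
  have restrict: "\<exists>vs'\<in>D. \<forall>t<N. vs' t = vs t" if adm: "admissible z zs vs" for zs vs
  proof -
    define vs' where "vs' t = (if t < N then vs t else vs 0)" for t
    have "traj z vs' t = zs t" if "t \<le> N" for t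
      using admissible_traj[OF adm that] traj_cong[of t vs' vs z] that by (simp add: vs'_def)
    then have "vs' \<in> D"
      using adm horizon by (auto simp: D_def mpc_admissible_def vs'_def)
    then show ?thesis by (intro bexI[of _ vs']) (simp_all add: vs'_def)
  qed
  have "compact {vs :: nat \<Rightarrow> real^'m. \<forall>t. vs t \<in> V}"
  proof -
    have "compactin (product_topology (\<lambda>_ :: nat. euclidean) UNIV) (PiE UNIV (\<lambda>_. V))"
      using compact_V by (simp add: compactin_PiE)
    moreover have "PiE UNIV (\<lambda>_. V) = {vs :: nat \<Rightarrow> real^'m. \<forall>t. vs t \<in> V}" by auto
    ultimately show ?thesis by (simp add: euclidean_product_topology)
  qed
  moreover have "closed {vs. (\<forall>t\<in>{1..<N}. traj z vs t \<in> Z) \<and> traj z vs N \<in> Zf}"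
  proof -
    have "{vs. (\<forall>t\<in>{1..<N}. traj z vs t \<in> Z) \<and> traj z vs N \<in> Zf} =
        (\<Inter>t\<in>{1..<N}. (\<lambda>vs. traj z vs t) -` Z) \<inter> (\<lambda>vs. traj z vs N) -` Zf" by auto
    also have "closed \<dots>"
      by (intro closed_Int closed_INT ballI closed_vimage closed_Z closed_Zf continuous_traj)
    finally show ?thesis .
  qed
  ultimately have "compact ({vs. \<forall>t. vs t \<in> V} \<inter> {vs. (\<forall>t\<in>{1..<N}. traj z vs t \<in> Z) \<and> traj z vs N \<in> Zf})"
    by (rule compact_Int_closed)
  also have "\<dots> = D" by (auto simp: D_def)
  finally have "compact D" .
  moreover have "D \<noteq> {}"
    using assms restrict by (fastforce simp: mpc_feasible_set_def)
  ultimately obtain vs where vs: "vs \<in> D"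
    "\<And>vs'. vs' \<in> D \<Longrightarrow> cost (traj z vs) vs \<le> cost (traj z vs') vs'"
    using continuous_attains_inf[of D "\<lambda>vs. cost (traj z vs) vs"]
      continuous_on_subset[OF continuous_cost] by blast
  have "minimizer z (traj z vs) vs"
    unfolding mpc_minimizer_def
  proof (intro conjI allI impI)
    show "admissible z (traj z vs) vs" using vs(1) by (simp add: admissible_traj_iff D_def)
    fix zs' vs' assume adm: "admissible z zs' vs'"
    then obtain vs'' where vs'': "vs'' \<in> D" "\<forall>t<N. vs'' t = vs' t"
      using restrict by blast
    have "cost (traj z vs) vs \<le> cost (traj z vs'') vs''" by (rule vs(2)[OF vs''(1)])
    also have "\<dots> = cost zs' vs'"
      using vs''(2) admissible_traj[OF adm] by (intro cost_cong) (auto intro!: traj_cong)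
    finally show "cost (traj z vs) vs \<le> cost zs' vs'" .
  qed
  then show ?thesis by (rule that)
qed

lemma admissible_midpoint:
  assumes "admissible z zs vs" "admissible z zs' vs'"
  shows "admissible z (\<lambda>t. (1/2) *\<^sub>R (zs t + zs' t)) (\<lambda>t. (1/2) *\<^sub>R (vs t + vs' t))"
proof -
  have mid: "(1/2) *\<^sub>R (x + y) \<in> S" if "convex S" "x \<in> S" "y \<in> S" for x y :: "'a :: real_vector" and S
    using convexD[OF that, of "1/2" "1/2"] by (simp add: scaleR_add_right)
  show ?thesis
    unfolding mpc_admissible_def
  proof (intro conjI allI impI)
    show "(1/2) *\<^sub>R (zs (Suc t) + zs' (Suc t)) =
        A *v ((1/2) *\<^sub>R (zs t + zs' t)) + B *v ((1/2) *\<^sub>R (vs t + vs' t))" if "t < N" for t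
      using assms that
      by (simp add: mpc_admissible_def matrix_vector_mult_scaleR matrix_vector_right_distrib
          scaleR_add_right)
    show "(1/2) *\<^sub>R (zs t + zs' t) \<in> Z" if "1 \<le> t \<and> t < N" for t
      using assms that by (intro mid convex_Z) (auto simp: mpc_admissible_def)
    show "(1/2) *\<^sub>R (vs t + vs' t) \<in> V" if "t < N" for t
      using assms that by (intro mid convex_V) (auto simp: mpc_admissible_def)
    show "(1/2) *\<^sub>R (zs N + zs' N) \<in> Zf"
      using assms by (intro mid convex_Zf) (auto simp: mpc_admissible_def)
    show "(1/2) *\<^sub>R (zs 0 + zs' 0) = z"
      using assms by (simp add: mpc_admissible_def scaleR_add_right scaleR_left_distrib[symmetric])
  qed
qed

lemma cost_midpoint:
  "cost (\<lambda>t. (1/2) *\<^sub>R (zs t + zs' t)) (\<lambda>t. (1/2) *\<^sub>R (vs t + vs' t)) =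
    (cost zs vs + cost zs' vs') / 2 - cost (\<lambda>t. zs t - zs' t) (\<lambda>t. vs t - vs' t) / 4"
proof -
  have "(\<Sum>t<N. stage ((1/2) *\<^sub>R (zs t + zs' t)) ((1/2) *\<^sub>R (vs t + vs' t))) =
      (\<Sum>t<N. (stage (zs t) (vs t) + stage (zs' t) (vs' t)) / 2 - stage (zs t - zs' t) (vs t - vs' t) / 4)"
    by (rule sum.cong[OF refl]) (simp only: stage_cost_def quadratic_form_midpoint, argo)
  also have "\<dots> = ((\<Sum>t<N. stage (zs t) (vs t)) + (\<Sum>t<N. stage (zs' t) (vs' t))) / 2 -
      (\<Sum>t<N. stage (zs t - zs' t) (vs t - vs' t)) / 4"
    by (simp only: sum.distrib sum_subtractf sum_divide_distrib[symmetric])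
  finally show ?thesis
    by (simp only: mpc_cost_def terminal_cost_def quadratic_form_midpoint) argo
qed

text \<open>The midpoint of two minimizers is admissible, so by \<open>cost_midpoint\<close> the cost of their
  difference cannot be positive; its first stage cost then vanishes.\<close>
lemma minimizer_first_control_unique:
  assumes "minimizer z zs vs" "minimizer z zs' vs'"
  shows "vs 0 = vs' 0"
proof -
  have eq: "cost zs vs = cost zs' vs'"
    using assms by (auto simp: mpc_minimizer_def intro: antisym)
  have "cost zs vs \<le> cost (\<lambda>t. (1/2) *\<^sub>R (zs t + zs' t)) (\<lambda>t. (1/2) *\<^sub>R (vs t + vs' t))"
    using assms admissible_midpoint by (simp add: mpc_minimizer_def)
  then have "cost (\<lambda>t. zs t - zs' t) (\<lambda>t. vs t - vs' t) \<le> 0"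
    by (simp add: cost_midpoint eq)
  then have "stage (zs 0 - zs' 0) (vs 0 - vs' 0) \<le> 0"
    using cost_ge_first_stage[of "\<lambda>t. zs t - zs' t" "\<lambda>t. vs t - vs' t"] by simp
  then have "(vs 0 - vs' 0) \<bullet> (R *v (vs 0 - vs' 0)) \<le> 0"
    using posdef_nonneg[OF posdef_Q, of "zs 0 - zs' 0"] by (simp add: stage_cost_def)
  then have "vs 0 - vs' 0 = 0"
    using posdef_R by (meson not_le posdef_def)
  then show ?thesis by simp
qed

lemma law_eq_first_control: "minimizer z zs vs \<Longrightarrow> law z = vs 0"
  unfolding mpc_law_def using minimizer_first_control_unique by (intro the_equality) blast+

text \<open>The tail of a plan, continued by one step of the terminal feedback, is a plan for the next
  state. By the terminal decrease, the appended stage cost is paid for by the drop in terminal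
  cost.\<close>
lemma terminal_extension:
  assumes adm: "admissible z zs vs"
  defines "zs' \<equiv> \<lambda>t. if t < N then zs (Suc t) else (A + B ** Kf) *v zs N"
    and "vs' \<equiv> \<lambda>t. if Suc t < N then vs (Suc t) else Kf *v zs N"
  shows "admissible (zs 1) zs' vs'" and "cost zs' vs' \<le> cost zs vs - stage (zs 0) (vs 0)"
proof -
  obtain n where n: "N = Suc n" using horizon by (cases N) auto
  have Zf: "zs N \<in> Zf" using adm by (simp add: mpc_admissible_def)
  show "admissible (zs 1) zs' vs'"
    unfolding mpc_admissible_def
  proof (intro conjI allI impI)
    show "zs' (Suc t) = A *v zs' t + B *v vs' t" if "t < N" for t
    proof (cases "Suc t < N")
      case True
      then show ?thesis using adm by (simp add: zs'_def vs'_def mpc_admissible_def)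
    next
      case False
      then have "Suc t = N" using that by simp
      then show ?thesis by (auto simp: zs'_def vs'_def closed_loop_matrix)
    qed
    show "zs' t \<in> Z" if "1 \<le> t \<and> t < N" for t
    proof (cases "Suc t < N")
      case True
      moreover have "\<And>t. 1 \<le> t \<Longrightarrow> t < N \<Longrightarrow> zs t \<in> Z"
        using adm by (simp add: mpc_admissible_def)
      ultimately show ?thesis by (simp add: zs'_def)
    next
      case False
      then have "Suc t = N" using that by simp
      then show ?thesis using that Zf Zf_subset by (auto simp: zs'_def)
    qed
    show "vs' t \<in> V" if "t < N" for t
      using that adm terminal_control[OF Zf] by (auto simp: vs'_def mpc_admissible_def)
    show "zs' N \<in> Zf" using terminal_invariant[OF Zf] by (simp add: zs'_def)
    show "zs' 0 = zs 1" using horizon by (simp add: zs'_def)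
  qed
  have "(\<Sum>t<N. stage (zs' t) (vs' t)) = (\<Sum>t<n. stage (zs (Suc t)) (vs (Suc t))) + stage (zs N) (Kf *v zs N)"
    by (simp add: n zs'_def vs'_def)
  moreover have "(\<Sum>t<N. stage (zs t) (vs t)) = stage (zs 0) (vs 0) + (\<Sum>t<n. stage (zs (Suc t)) (vs (Suc t)))"
    unfolding n by (rule sum.lessThan_Suc_shift)
  ultimately show "cost zs' vs' \<le> cost zs vs - stage (zs 0) (vs 0)"
    using terminal_decrease[OF Zf] by (simp add: mpc_cost_def zs'_def)
qed

text \<open>Using the terminal feedback from the start, the stage costs telescope against the terminal
  cost.\<close>
lemma terminal_policy:
  assumes "z \<in> Zf"
  obtains zs vs where "admissible z zs vs" "cost zs vs \<le> terminal_cost P z"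
proof
  define zs where "zs t = ((*v) (A + B ** Kf) ^^ t) z" for t
  have Zf: "zs t \<in> Zf" for t
    by (induction t) (simp_all add: zs_def assms terminal_invariant)
  show "admissible z zs (\<lambda>t. Kf *v zs t)"
    using Zf Zf_subset terminal_control
    by (auto simp: mpc_admissible_def zs_def closed_loop_matrix)
  have "(\<Sum>t<m. stage (zs t) (Kf *v zs t)) + terminal_cost P (zs m) \<le> terminal_cost P z" for m
  proof (induction m)
    case (Suc m)
    then show ?case using terminal_decrease[OF Zf[of m]] by (simp add: zs_def)
  qed (simp add: zs_def)
  then show "cost zs (\<lambda>t. Kf *v zs t) \<le> terminal_cost P z" by (simp add: mpc_cost_def)
qed

lemma Zf_feasible: "Zf \<subseteq> feasible"
proof
  fix z assume "z \<in> Zf"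
  then obtain zs vs where "admissible z zs vs" by (rule terminal_policy)
  then show "z \<in> feasible" unfolding mpc_feasible_set_def by blast
qed

text \<open>All minimizers of the problem at \<open>z\<close> have the same cost, so the choice is immaterial; outside
  the feasible set the value is arbitrary.\<close>
definition optimal_cost :: "real^'n \<Rightarrow> real" where
  "optimal_cost z = (SOME c. \<exists>zs vs. minimizer z zs vs \<and> c = cost zs vs)"

lemma optimal_cost_eq:
  assumes "minimizer z zs vs"
  shows "optimal_cost z = cost zs vs"
proof -
  have "\<exists>zs vs. minimizer z zs vs \<and> optimal_cost z = cost zs vs"
    unfolding optimal_cost_def by (rule someI_ex) (use assms in blast)
  then obtain zs' vs' where min: "minimizer z zs' vs'" and eq: "optimal_cost z = cost zs' vs'"
    by blast
  have "cost zs' vs' \<le> cost zs vs" "cost zs vs \<le> cost zs' vs'"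
    using min assms unfolding mpc_minimizer_def by simp_all
  with eq show ?thesis by simp
qed

lemma optimal_cost_le:
  assumes "admissible z zs vs"
  shows "optimal_cost z \<le> cost zs vs"
proof -
  have "z \<in> feasible"
    unfolding mpc_feasible_set_def using assms by blast
  then obtain zs' vs' where min: "minimizer z zs' vs'"
    by (rule minimizer_exists)
  then have "cost zs' vs' \<le> cost zs vs"
    using assms unfolding mpc_minimizer_def by simp
  then show ?thesis using optimal_cost_eq[OF min] by simp
qed

definition closed_loop :: "real^'n \<Rightarrow> real^'n" where
  "closed_loop z = A *v z + B *v law z"

lemma closed_loop_descent:
  assumes "z \<in> feasible"
  shows "closed_loop z \<in> feasible"
    and "optimal_cost (closed_loop z) \<le> optimal_cost z - stage z (law z)"
proof -
  obtain zs vs where min: "minimizer z zs vs" using minimizer_exists[OF assms] .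
  then have adm: "admissible z zs vs" by (simp add: mpc_minimizer_def)
  have "zs 1 = closed_loop z" "zs 0 = z"
    using adm horizon law_eq_first_control[OF min]
    by (auto simp: mpc_admissible_def closed_loop_def)
  note ext = terminal_extension[OF adm, unfolded this]
  show "closed_loop z \<in> feasible"
    using ext(1) by (auto simp: mpc_feasible_set_def)
  show "optimal_cost (closed_loop z) \<le> optimal_cost z - stage z (law z)"
    using optimal_cost_le[OF ext(1)] ext(2) optimal_cost_eq[OF min] law_eq_first_control[OF min]
    by simp
qed

lemma iterates_feasible: "z \<in> feasible \<Longrightarrow> (closed_loop ^^ k) z \<in> feasible"
  by (induction k) (simp_all add: closed_loop_descent)

lemma stage_le_optimal_cost:
  assumes "z \<in> feasible"
  shows "stage z (law z) \<le> optimal_cost z"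
proof -
  obtain zs vs where min: "minimizer z zs vs" using minimizer_exists[OF assms] .
  then have "zs 0 = z" by (simp add: mpc_minimizer_def mpc_admissible_def)
  then show ?thesis
    using cost_ge_first_stage[of zs vs] optimal_cost_eq[OF min] law_eq_first_control[OF min] by simp
qed

lemma optimal_cost_le_terminal_cost: "z \<in> Zf \<Longrightarrow> optimal_cost z \<le> terminal_cost P z"
  by (rule terminal_policy, assumption) (rule order.trans[OF optimal_cost_le])

lemma closed_loop_0: "closed_loop 0 = 0"
proof -
  have "0 \<in> Zf" using zero_interior interior_subset by blast
  then have "stage 0 (law 0) \<le> 0"
    using stage_le_optimal_cost[of 0] Zf_feasible optimal_cost_le_terminal_cost[of 0]
    by (auto simp: terminal_cost_def)
  then have "law 0 \<bullet> (R *v law 0) \<le> 0" by (simp add: stage_cost_def)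
  then have "law 0 = 0" using posdef_R by (meson not_le posdef_def)
  then show ?thesis by (simp add: closed_loop_def)
qed

lemma total_cost_bound:
  assumes "z \<in> feasible"
  shows "(\<Sum>k<m. stage ((closed_loop ^^ k) z) (law ((closed_loop ^^ k) z))) +
    optimal_cost ((closed_loop ^^ m) z) \<le> optimal_cost z"
proof (induction m)
  case (Suc m)
  then show ?case
    using closed_loop_descent(2)[OF iterates_feasible[OF assms, of m]] by simp
qed simp

text \<open>The optimal cost is a Lyapunov function: it dominates \<open>q \<parallel>z\<parallel>\<^sup>2\<close> on the feasible set, is at
  most \<open>b \<parallel>z\<parallel>\<^sup>2\<close> near the origin and does not increase, which gives Lyapunov stability. Convergence
  holds because the total stage cost is finite.\<close>
lemma asymptotically_stable: "asymptotically_stable_on feasible closed_loop"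
proof -
  obtain q where q: "q > 0" "\<And>x. q * (norm x)\<^sup>2 \<le> x \<bullet> (Q *v x)"
    using posdef_lower_bound[OF posdef_Q] by metis
  obtain b where b: "b > 0" "\<And>x. x \<bullet> (P *v x) \<le> b * (norm x)\<^sup>2"
    using quadratic_form_upper_bound[of P] by metis
  have lower: "q * (norm z)\<^sup>2 \<le> stage z v" for z v
    using q(2)[of z] posdef_nonneg[OF posdef_R, of v] by (simp add: stage_cost_def)
  have lower_opt: "q * (norm z)\<^sup>2 \<le> optimal_cost z" if "z \<in> feasible" for z
    using lower stage_le_optimal_cost[OF that] by (rule order.trans)
  obtain r where r: "r > 0" "ball 0 r \<subseteq> Zf"
    using zero_interior by (meson mem_interior)
  show ?thesis
    unfolding asymptotically_stable_on_def
  proof (intro conjI allI impI ballI)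
    show "0 \<in> feasible" using zero_interior interior_subset Zf_feasible by blast
    show "closed_loop 0 = 0" by (rule closed_loop_0)
    fix e :: real assume e: "e > 0"
    show "\<exists>\<delta>>0. \<forall>z\<in>feasible. norm z < \<delta> \<longrightarrow> (\<forall>k. norm ((closed_loop ^^ k) z) < e)"
    proof (intro exI conjI ballI impI allI)
      \<comment> \<open>The second bound on \<open>\<delta>\<close> solves \<open>b \<delta>\<^sup>2 = q e\<^sup>2\<close>; the first keeps the start in \<open>Zf\<close>.\<close>
      show "min r (e * sqrt (q / b)) > 0" using r(1) e q(1) b(1) by simp
      fix z k assume z: "z \<in> feasible" "norm z < min r (e * sqrt (q / b))"
      have "z \<in> Zf" using z(2) r(2) by auto
      have "q * (norm ((closed_loop ^^ k) z))\<^sup>2 \<le> optimal_cost ((closed_loop ^^ k) z)"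
        by (rule lower_opt[OF iterates_feasible[OF z(1)]])
      also have "\<dots> \<le> optimal_cost z"
        using total_cost_bound[OF z(1), of k]
          sum_nonneg[of "{..<k}" "\<lambda>k. stage ((closed_loop ^^ k) z) (law ((closed_loop ^^ k) z))"]
        by (simp add: stage_nonneg)
      also have "\<dots> \<le> b * (norm z)\<^sup>2"
        using optimal_cost_le_terminal_cost[OF \<open>z \<in> Zf\<close>] b(2)[of z] by (simp add: terminal_cost_def)
      also have "\<dots> < b * (e * sqrt (q / b))\<^sup>2"
        using z(2) b(1) by (intro mult_strict_left_mono power_strict_mono) auto
      also have "\<dots> = q * e\<^sup>2"
        using q(1) b(1) by (simp add: power_mult_distrib)
      finally have "(norm ((closed_loop ^^ k) z))\<^sup>2 < e\<^sup>2" using q(1) by simp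
      then show "norm ((closed_loop ^^ k) z) < e"
        using e power2_less_imp_less by (metis less_imp_le)
    qed
  next
    fix z assume z: "z \<in> feasible"
    define l where "l k = stage ((closed_loop ^^ k) z) (law ((closed_loop ^^ k) z))" for k
    have "(\<Sum>k<m. l k) \<le> optimal_cost z" for m
    proof -
      have "0 \<le> optimal_cost ((closed_loop ^^ m) z)"
        using lower_opt[OF iterates_feasible[OF z, of m]] q(1)
        by (smt (verit) mult_nonneg_nonneg zero_le_power2)
      then show ?thesis using total_cost_bound[OF z, of m] by (simp add: l_def)
    qed
    then have "summable l"
      by (intro summableI_nonneg_bounded) (simp_all add: l_def stage_nonneg)
    then have "(\<lambda>k. l k / q) \<longlonglongrightarrow> 0"
      using tendsto_divide[OF summable_LIMSEQ_zero tendsto_const, of l q] q(1) by simp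
    then have "(\<lambda>k. (norm ((closed_loop ^^ k) z))\<^sup>2) \<longlonglongrightarrow> 0"
      by (rule Lim_null_comparison[rotated])
        (use lower q(1) in \<open>auto simp: l_def field_simps intro!: always_eventually\<close>)
    then have "(\<lambda>k. sqrt ((norm ((closed_loop ^^ k) z))\<^sup>2)) \<longlonglongrightarrow> sqrt 0"
      by (rule tendsto_real_sqrt)
    then show "(\<lambda>k. (closed_loop ^^ k) z) \<longlonglongrightarrow> 0"
      by (simp add: tendsto_norm_zero_iff)
  qed
qed

end

section \<open>The tube MPC closed loop\<close>

theorem theorem1:
  fixes A :: "real^'n^'n" and B :: "real^'m^'n"
    and K Kf :: "real^'n^'m"
    and X Z Zf XN :: "(real^'n) set" and U V :: "(real^'m) set"
    and f :: "nat \<Rightarrow> real^'n" and nX :: nat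
    and g :: "nat \<Rightarrow> real^'m" and nU :: nat
    and M :: "'a measure" and w :: "nat \<Rightarrow> 'a \<Rightarrow> real^'n"
    and \<omega> :: "(real^'n) measure" and \<mu> :: "real^'n" and \<Sigma> :: "real^'n^'n"
    and \<epsilon>x \<epsilon>u :: real
    and p :: "'r::finite \<Rightarrow> real^'n" and cx cu qx qu :: "real^'r"
    and P Q :: "real^'n^'n" and R :: "real^'m^'m" and N :: nat
    and \<kappa> :: "real^'n \<Rightarrow> real^'m" and F :: "real^'n \<Rightarrow> real^'n"
  assumes prob: "prob_space M"
    and iid: "prob_space.indep_vars M (\<lambda>_. borel) w UNIV" "\<And>k. distr M borel (w k) = \<omega>"
    and eps: "0 < \<epsilon>x" "\<epsilon>x < 1" "0 < \<epsilon>u" "\<epsilon>u < 1"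
    and A1i: "strictly_stabilizable A B"
    and A1ii: "polyhedron X" "0 \<in> interior X" "irredundant_rep X f nX"
      "polytope U" "0 \<in> interior U" "irredundant_rep U g nU"
    and A1iii: "integrable \<omega> (\<lambda>x. (norm x)\<^sup>2)" "mean_vector \<omega> = \<mu>"
      "covariance_matrix \<omega> = \<Sigma>" "posdef \<Sigma>"
    and A2: "strictly_stable (A + B ** K)"
    and A3: "0 \<in> interior (ellipsoid \<Sigma> \<mu> (real CARD('n) / \<epsilon>x))"
      "0 \<in> interior (ellipsoid \<Sigma> \<mu> (real CARD('n) / \<epsilon>u))"
    and p_span: "span (range p) = UNIV"
    and qx: "lp_c_solution (A + B ** K) p (d_star p \<mu> \<Sigma> \<epsilon>x) cx" "qx = cx + d_star p \<mu> \<Sigma> \<epsilon>x"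
    and qu: "lp_c_solution (A + B ** K) p (d_star p \<mu> \<Sigma> \<epsilon>u) cu" "qu = cu + d_star p \<mu> \<Sigma> \<epsilon>u"
    and Z: "Z = pontryagin_diff X (reach_set p qx)"
    and V: "V = pontryagin_diff U ((\<lambda>x. K *v x) ` reach_set p qu)"
    and A4: "Z \<noteq> {}" "polyhedron Z" "0 \<in> interior Z"
      "V \<noteq> {}" "polytope V" "0 \<in> interior V"
    and costs: "posdef P" "posdef Q" "posdef R"
    and A5i: "strictly_stable (A + B ** Kf)" "polyhedron Zf"
      "maximal_positively_invariant (\<lambda>z. (A + B ** Kf) *v z) {z. (z, Kf *v z) \<in> Z \<times> V} Zf"
    and A5ii: "\<And>z. z \<in> Zf \<Longrightarrow>
      terminal_cost P ((A + B ** Kf) *v z) + stage_cost Q R z (Kf *v z) \<le> terminal_cost P z"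
    and N: "N \<ge> 1"
    and XN: "XN = mpc_feasible_set A B Z V Zf N"
    and \<kappa>: "\<kappa> = mpc_law A B Z V Zf Q R P N"
    and F: "F = (\<lambda>z. A *v z + B *v \<kappa> z)"
  shows "(\<forall>z0\<in>XN. \<forall>k. (F ^^ k) z0 \<in> XN) \<and>
    asymptotically_stable_on XN F \<and>
    (\<exists>!\<rho>. stationary_law (A + B ** K) \<omega> \<rho>) \<and>
    (\<forall>\<rho>. stationary_law (A + B ** K) \<omega> \<rho> \<longrightarrow>
      (\<forall>z0\<in>XN. \<forall>x u.
        closed_loop_process M w A B (\<lambda>k. tube_feedback \<kappa> K ((F ^^ k) z0)) x u \<longrightarrow>
        converges_weakly (\<lambda>k. distr M borel (x k)) \<rho>))"
proof -
  have sets_\<omega>: "sets \<omega> = sets borel"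
    using iid(2)[of 0] by auto
  have "w 0 \<in> borel_measurable M"
    using iid(1) by (simp add: prob_space.indep_vars_def2[OF prob])
  then have prob_\<omega>: "prob_space \<omega>"
    using prob_space.prob_space_distr[OF prob] iid(2)[of 0] by metis
  have integrable_norm: "integrable \<omega> (\<lambda>x. norm x)"
  proof (rule Bochner_Integration.integrable_bound)
    have "finite_measure \<omega>" using prob_\<omega> by (rule prob_space.finite_measure)
    then show "integrable \<omega> (\<lambda>x. 1 + (norm x)\<^sup>2)"
      using A1iii(1) by (intro Bochner_Integration.integrable_add finite_measure.integrable_const)
    show "(\<lambda>x. norm x) \<in> borel_measurable \<omega>"
      unfolding measurable_cong_sets[OF sets_\<omega> refl] by simp
    have "norm x \<le> 1 + (norm x)\<^sup>2" for x :: "real^'n"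
      using sum_power2_ge_zero[of "norm x - 1" "norm x"] by (simp add: power2_eq_square algebra_simps)
    then show "AE x in \<omega>. norm (norm x) \<le> norm (1 + (norm x)\<^sup>2)" by simp
  qed
  interpret noise: stable_noise "A + B ** K" \<omega>
    by (rule stable_noise.intro[OF A2 prob_\<omega> sets_\<omega> integrable_norm])

  let ?C = "{z. (z, Kf *v z) \<in> Z \<times> V}"
  have invariant: "positively_invariant (\<lambda>z. (A + B ** Kf) *v z) ?C Zf"
    using A5i(3) by (simp add: maximal_positively_invariant_def)
  have "0 \<in> interior ?C"
  proof (rule interiorI)
    show "open (interior Z \<inter> (\<lambda>z. Kf *v z) -` interior V)"
      by (intro open_Int open_vimage open_interior continuous_intros)
    show "0 \<in> interior Z \<inter> (\<lambda>z. Kf *v z) -` interior V"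
      using A4(3,6) by simp
    show "interior Z \<inter> (\<lambda>z. Kf *v z) -` interior V \<subseteq> ?C"
      using interior_subset[of Z] interior_subset[of V] by auto
  qed
  then have zero_Zf: "0 \<in> interior Zf"
    by (rule zero_interior_maximal_invariant[OF A5i(1) _ A5i(3)])
  interpret mpc: nominal_mpc A B Z Zf V Q P R N Kf
  proof (rule nominal_mpc.intro)
    show "closed Z" "convex Z" "closed Zf" "convex Zf"
      using A4(2) A5i(2) by (simp_all add: polyhedron_imp_closed polyhedron_imp_convex)
    show "compact V" "convex V"
      using A4(5) by (simp_all add: polytope_imp_compact polytope_imp_convex)
    show "Zf \<subseteq> Z" and "\<And>z. z \<in> Zf \<Longrightarrow> Kf *v z \<in> V"
      and "\<And>z. z \<in> Zf \<Longrightarrow> (A + B ** Kf) *v z \<in> Zf"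
      using invariant unfolding positively_invariant_def by blast+
  qed (fact costs zero_Zf A5ii N)+
  have F_eq: "F = mpc.closed_loop"
    by (simp add: F \<kappa> mpc.closed_loop_def fun_eq_iff)
  have stable: "asymptotically_stable_on XN F"
    unfolding XN F_eq by (rule mpc.asymptotically_stable)

  show ?thesis
  proof (intro conjI allI impI ballI)
    show "(F ^^ k) z0 \<in> XN" if "z0 \<in> XN" for z0 k
      using that unfolding XN F_eq by (rule mpc.iterates_feasible)
    show "asymptotically_stable_on XN F" by (rule stable)
    show "\<exists>!\<rho>. stationary_law (A + B ** K) \<omega> \<rho>" by (rule noise.ex1_stationary_law)
    fix \<rho> z0 x u
    assume \<rho>: "stationary_law (A + B ** K) \<omega> \<rho>" and z0: "z0 \<in> XN"
      and x: "closed_loop_process M w A B (\<lambda>k. tube_feedback \<kappa> K ((F ^^ k) z0)) x u"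
    have "(\<lambda>k. (F ^^ k) z0) \<longlonglongrightarrow> 0"
      using stable z0 by (simp add: asymptotically_stable_on_def)
    then show "converges_weakly (\<lambda>k. distr M borel (x k)) \<rho>"
      unfolding noise.stationary_law_unique[OF \<rho>]
      by (intro noise.tube_state_converges[OF prob iid(2) refl _ _ x]) (simp_all add: F)
  qed
qed

end
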